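(* Let $g\in W_0^N(\mathbb{R})$ have stable integer shifts and let $(\Lambda,m_\Lambda)$ be a separated set with multiplicity and height at most $N<\infty$. Then the following are equivalent: (a) $(\Lambda,m_\Lambda)$ is a sampling set for $V^p(g)$ for some $p\in[1,\infty]$; (b) $(\Lambda,m_\Lambda)$ is a sampling set for $V^p(g)$ for all $p\in[1,\infty]$; (c) every weak limit $(\Gamma,m_\Gamma)\in W_{\mathbb{Z}}(\Lambda,m_\Lambda)$ is a sampling set for $V^\infty(g)$; (d) every weak limit $(\Gamma,m_\Gamma)\in W_{\mathbb{Z}}(\Lambda,m_\Lambda)$ is a set of uniqueness for $V^\infty(g)$.
   Context: $W_0(\mathbb{R})$ is the space of continuous $h$ with $\sum_{k\in\mathbb{Z}}\max_{x\in[k,k+1]}|h(x)|<\infty$; $W_0^N(\mathbb{R})$ is the class of functions whose derivatives up to order $N-1$ lie in $W_0(\mathbb{R})$. $V^p(g)=\{f=\sum_{k\in\mathbb{Z}}c_kg(\cdot-k):c\in\ell^p(\mathbb{Z})\}$; $g$ has stable integer shifts if $\|\sum_kc_kg(\cdot-k)\|_p\asymp\|c\|_p$ for $1\le p\le\infty$. A set with multiplicity is $(\Lambda,m_\Lambda)$, $m_\Lambda:\Lambda\to\mathbb{N}$, with height $\sup m_\Lambda$; separated means distinct points are uniformly apart. $(\Lambda,m_\Lambda)$ is a sampling set for $V^p(g)$, $p<\infty$, if $A\|f\|_p^p\le\sum_{\lambda}\sum_{j=0}^{m_\Lambda(\lambda)-1}|f^{(j)}(\lambda)|^p\le B\|f\|_p^p$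 for all $f\in V^p(g)$, and for $p=\infty$ if $A\|f\|_\infty\le\sup_\lambda\max_{0\le j<m_\Lambda(\lambda)}|f^{(j)}(\lambda)|\le B\|f\|_\infty$. $(\Gamma,m_\Gamma)$ is a set of uniqueness for $V^\infty(g)$ if $f\in V^\infty(g)$ with $f^{(j)}(\gamma)=0$ for all $\gamma\in\Gamma$, $0\le j<m_\Gamma(\gamma)$, implies $f\equiv0$. Weak convergence of sets: $\Lambda_n\to\Lambda'$ weakly if for each bounded open interval $(a,b)$ and $\varepsilon>0$, for large $n$, $\Lambda_n\cap(a,b)\subseteq\Lambda'+(-\varepsilon,\varepsilon)$ and $\Lambda'\cap(a,b)\subseteq\Lambda_n+(-\varepsilon,\varepsilon)$. With $\Lambda^j=\{\lambda:m_\Lambda(\lambda)\ge j\}$, $(\Gamma,m_\Gamma)\in W_{\mathbb{Z}}(\Lambda,m_\Lambda)$ means there are sets $\Gamma^1,\dots,\Gamma^N$ and $(k_n)\subseteq\mathbb{Z}$ with $\Lambda^j+k_n\to\Gamma^j$ weakly for all $j$, and $\Gamma=\Gamma^1$, $m_\Gamma(\gamma)=\max\{j:\gamma\in\Gamma^j\}$. *)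

theory Defs
  imports "HOL-Analysis.Analysis"
begin

fun nderiv :: "nat \<Rightarrow> (real \<Rightarrow> 'a::real_normed_vector) \<Rightarrow> real \<Rightarrow> 'a" where
  "nderiv 0 f = f"
| "nderiv (Suc j) f = (\<lambda>x. vector_derivative (nderiv j f) (at x))"

definition W0 :: "(real \<Rightarrow> complex) \<Rightarrow> bool" where
  "W0 h \<longleftrightarrow> continuous_on UNIV h \<and>
     (\<lambda>k::int. Sup ((\<lambda>x. norm (h x)) ` {real_of_int k .. real_of_int k + 1})) summable_on UNIV"

definition W0N :: "nat \<Rightarrow> (real \<Rightarrow> complex) \<Rightarrow> bool" where
  "W0N N g \<longleftrightarrow> (\<forall>j. j + 1 < N \<longrightarrow> (\<forall>x. nderiv j g differentiable at x)) \<and>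
     (\<forall>j<N. W0 (nderiv j g))"

definition shiftsum :: "(real \<Rightarrow> complex) \<Rightarrow> (int \<Rightarrow> complex) \<Rightarrow> real \<Rightarrow> complex" where
  "shiftsum g c = (\<lambda>x. \<Sum>\<^sub>\<infinity>k\<in>UNIV. c k * g (x - real_of_int k))"

definition lp_space :: "ereal \<Rightarrow> (int \<Rightarrow> complex) \<Rightarrow> bool" where
  "lp_space p c \<longleftrightarrow> (if p = \<infinity> then bounded (range c)
     else (\<lambda>k. norm (c k) powr real_of_ereal p) summable_on UNIV)"

definition Vp :: "(real \<Rightarrow> complex) \<Rightarrow> ereal \<Rightarrow> (real \<Rightarrow> complex) set" where
  "Vp g p = {shiftsum g c | c. lp_space p c}"

definition lp_sum :: "real \<Rightarrow> (int \<Rightarrow> complex) \<Rightarrow> ennreal" where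
  "lp_sum p c = (\<Sum>\<^sub>\<infinity>k\<in>UNIV. ennreal (norm (c k) powr p))"

definition Lp_int :: "real \<Rightarrow> (real \<Rightarrow> complex) \<Rightarrow> ennreal" where
  "Lp_int p f = (\<integral>\<^sup>+ x. ennreal (norm (f x) powr p) \<partial>lborel)"

definition sup_seq :: "(int \<Rightarrow> complex) \<Rightarrow> ennreal" where
  "sup_seq c = (SUP k. ennreal (norm (c k)))"

definition sup_fun :: "(real \<Rightarrow> complex) \<Rightarrow> ennreal" where
  "sup_fun f = (SUP x. ennreal (norm (f x)))"

definition stable_shifts :: "(real \<Rightarrow> complex) \<Rightarrow> bool" where
  "stable_shifts g \<longleftrightarrow>
     (\<forall>p::real. 1 \<le> p \<longrightarrow> (\<exists>A B. 0 < A \<and> 0 < B \<and>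
        (\<forall>c. lp_space (ereal p) c \<longrightarrow>
           ennreal A * lp_sum p c \<le> Lp_int p (shiftsum g c) \<and>
           Lp_int p (shiftsum g c) \<le> ennreal B * lp_sum p c))) \<and>
     (\<exists>A B. 0 < A \<and> 0 < B \<and>
        (\<forall>c. lp_space \<infinity> c \<longrightarrow>
           ennreal A * sup_seq c \<le> sup_fun (shiftsum g c) \<and>
           sup_fun (shiftsum g c) \<le> ennreal B * sup_seq c))"

definition mult_set :: "real set \<Rightarrow> (real \<Rightarrow> nat) \<Rightarrow> bool" where
  "mult_set L m \<longleftrightarrow> (\<forall>l\<in>L. 1 \<le> m l)"

definition separated :: "real set \<Rightarrow> bool" where
  "separated L \<longleftrightarrow> (\<exists>\<delta>>0. \<forall>x\<in>L. \<forall>y\<in>L. x \<noteq> y \<longrightarrow> \<delta> \<le> \<bar>x - y\<bar>)"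

definition sampling_set :: "(real \<Rightarrow> complex) \<Rightarrow> ereal \<Rightarrow> real set \<Rightarrow> (real \<Rightarrow> nat) \<Rightarrow> bool" where
  "sampling_set g p L m \<longleftrightarrow>
    (if p = \<infinity> then
       (\<exists>A B. 0 < A \<and> 0 < B \<and> (\<forall>f\<in>Vp g \<infinity>.
          ennreal A * sup_fun f \<le> (SUP (l, j)\<in>{(l, j). l \<in> L \<and> j < m l}. ennreal (norm (nderiv j f l))) \<and>
          (SUP (l, j)\<in>{(l, j). l \<in> L \<and> j < m l}. ennreal (norm (nderiv j f l))) \<le> ennreal B * sup_fun f))
     else
       (\<exists>A B. 0 < A \<and> 0 < B \<and> (\<forall>f\<in>Vp g p.
          ennreal A * Lp_int (real_of_ereal p) f
            \<le> (\<Sum>\<^sub>\<infinity>l\<in>L. \<Sum>j<m l. ennreal (norm (nderiv j f l) powr real_of_ereal p)) \<and>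
          (\<Sum>\<^sub>\<infinity>l\<in>L. \<Sum>j<m l. ennreal (norm (nderiv j f l) powr real_of_ereal p))
            \<le> ennreal B * Lp_int (real_of_ereal p) f)))"

definition uniqueness_set :: "(real \<Rightarrow> complex) \<Rightarrow> real set \<Rightarrow> (real \<Rightarrow> nat) \<Rightarrow> bool" where
  "uniqueness_set g G m \<longleftrightarrow>
    (\<forall>f\<in>Vp g \<infinity>. (\<forall>y\<in>G. \<forall>j<m y. nderiv j f y = 0) \<longrightarrow> (\<forall>x. f x = 0))"

definition nbhd :: "real set \<Rightarrow> real \<Rightarrow> real set" where
  "nbhd S \<epsilon> = {x. \<exists>y\<in>S. \<bar>x - y\<bar> < \<epsilon>}"

definition weak_conv :: "(nat \<Rightarrow> real set) \<Rightarrow> real set \<Rightarrow> bool" where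
  "weak_conv Ls L' \<longleftrightarrow> (\<forall>a b \<epsilon>. 0 < \<epsilon> \<longrightarrow> (\<exists>n0. \<forall>n\<ge>n0.
      Ls n \<inter> {a<..<b} \<subseteq> nbhd L' \<epsilon> \<and> L' \<inter> {a<..<b} \<subseteq> nbhd (Ls n) \<epsilon>))"

definition level_set :: "real set \<Rightarrow> (real \<Rightarrow> nat) \<Rightarrow> nat \<Rightarrow> real set" where
  "level_set L m j = {l \<in> L. j \<le> m l}"

text \<open>(G, mG) is in W_Z(L, m) (N is the height bound).\<close>
definition WZ :: "nat \<Rightarrow> real set \<Rightarrow> (real \<Rightarrow> nat) \<Rightarrow> real set \<Rightarrow> (real \<Rightarrow> nat) \<Rightarrow> bool" where
  "WZ N L m G mG \<longleftrightarrow> (\<exists>Gs :: nat \<Rightarrow> real set. \<exists>k :: nat \<Rightarrow> int.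
     (\<forall>j\<in>{1..N}. weak_conv (\<lambda>n. (\<lambda>x. x + real_of_int (k n)) ` level_set L m j) (Gs j)) \<and>
     G = Gs 1 \<and> (\<forall>y\<in>G. mG y = Max {j \<in> {1..N}. y \<in> Gs j}))"

end

theory Submission
  imports Defs "HOL-Complex_Analysis.Great_Picard"
begin

text \<open>
  The samples of \<open>f = \<Sum> c\<^sub>k g(\<cdot> - k)\<close> are the image of \<open>c\<close> under the matrix \<open>g\<^bsup>(j)\<^esup>(\<lambda> - k)\<close>, whose
  entries are dominated by a summable function of the distance to the diagonal; by stability of the
  shifts, sampling for \<open>V\<^sup>p(g)\<close> means that this matrix is bounded below on \<open>\<ell>\<^sup>p\<close>. The commutator of such a
  matrix with a trapezoidal cutoff of scale \<open>R\<close> tends to 0 as \<open>R \<rightarrow> \<infinity>\<close>, uniformly in the position of the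
  cutoff. Hence a lower bound on \<open>\<ell>\<^sup>p\<close> can be localised to windows of a fixed size, where all norms are
  equivalent, and the commutator error is absorbed after taking the supremum (from \<open>p < \<infinity>\<close> to \<open>\<infinity>\<close>) or
  the sum (from \<open>\<infinity>\<close> to \<open>p < \<infinity>\<close>) over all windows.

  A lower bound on \<open>\<ell>\<^sup>\<infinity>\<close> passes to finitely supported sequences on a weak limit, and from these back to
  all bounded sequences by the previous argument. Conversely, if the lower bound fails, suitably
  translated and normalised bounded sequences with small samples have, together with the translated
  sets, a convergent subsequence, whose limit violates uniqueness on a weak limit.
\<close>

section \<open>Sums and convexity\<close>

text \<open>All conditions are compared with the sampling property of the given set for
  \<open>p = \<infinity>\<close>. Two points shape the argument. Absorbing the commutator error, as
  in \<open>S \<le> a + S / 2\<close>, is legitimate only if \<open>S\<close> is known to be finite;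
  hence \<open>S\<close> is a supremum of window sums for bounded sequences and a sum of window
  suprema for p-summable ones. Moreover, the lower bound is applied to cut-off sequences only, so
  both localisation theorems assume it on finitely supported sequences and conclude it for all
  bounded, respectively p-summable, ones. This asymmetry makes weak limits tractable: weak
  convergence compares sets on bounded intervals, and a finite combination of shifts decays at
  infinity, so its far samples are harmless, whereas a bounded combination need not decay. The
  commutator is small because its entries at distance \<open>t\<close> from the diagonal are at most
  \<open>\<theta> t * min 1 (\<bar>t\<bar> / R)\<close>, whose sum tends to 0 by dominated
  convergence.\<close>

lemma infsum_ennreal_eq_nn_integral:
  fixes f :: "'a \<Rightarrow> ennreal"
  assumes "countable A"
  shows "infsum f A = (\<integral>\<^sup>+x. f x \<partial>count_space A)"
proof (rule antisym)
  have "sum f F \<le> (\<integral>\<^sup>+x. f x \<partial>count_space A)" if "finite F" "F \<subseteq> A" for F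
  proof -
    have "sum f F = (\<integral>\<^sup>+x. f x * indicator F x \<partial>count_space A)"
      using that by (subst nn_integral_count_space'[of F]) (auto simp: indicator_def)
    also have "\<dots> \<le> (\<integral>\<^sup>+x. f x \<partial>count_space A)"
      by (intro nn_integral_mono) (auto simp: indicator_def)
    finally show ?thesis .
  qed
  then show "infsum f A \<le> (\<integral>\<^sup>+x. f x \<partial>count_space A)"
    by (subst nonneg_infsum_complete) (auto intro!: SUP_least)
next
  show "(\<integral>\<^sup>+x. f x \<partial>count_space A) \<le> infsum f A"
  proof (cases "A = {}")
    case True
    then show ?thesis by (simp add: nn_integral_count_space_finite)
  next
    case False
    \<comment> \<open>The first \<open>n\<close> points of an enumeration: countability turns the
      directed supremum over finite subsets into an increasing sequence, to which monotone
      convergence applies. Integrals against counting measure are preferred from here on because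
      Tonelli's theorem is at hand for them.\<close>
    define F where "F n = from_nat_into A ` {..<n::nat}" for n
    have F: "finite (F n)" "F n \<subseteq> A" for n
      using False from_nat_into[OF False] by (auto simp: F_def)
    have "(\<integral>\<^sup>+x. f x \<partial>count_space A) = (\<integral>\<^sup>+x. (SUP n. f x * indicator (F n) x) \<partial>count_space A)"
    proof (rule nn_integral_cong)
      fix x assume "x \<in> space (count_space A)"
      then obtain k where k: "x = from_nat_into A k"
        using from_nat_into_surj[OF assms] by (metis space_count_space)
      have "f x = f x * indicator (F (Suc k)) x"
        using k by (auto simp: F_def indicator_def)
      also have "\<dots> \<le> (SUP n. f x * indicator (F n) x)"
        by (rule SUP_upper) simp
      finally show "f x = (SUP n. f x * indicator (F n) x)"
        by (intro antisym SUP_least) (auto simp: indicator_def)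
    qed
    also have "\<dots> = (SUP n. \<integral>\<^sup>+x. f x * indicator (F n) x \<partial>count_space A)"
    proof (rule nn_integral_monotone_convergence_SUP)
      show "incseq (\<lambda>n x. f x * indicator (F n) x)"
        by (rule incseq_SucI) (auto simp: F_def le_fun_def indicator_def)
    qed simp
    also have "\<dots> \<le> infsum f A"
    proof (rule SUP_least)
      fix n
      have "(\<integral>\<^sup>+x. f x * indicator (F n) x \<partial>count_space A) = sum f (F n)"
        using F by (subst nn_integral_count_space'[of "F n"]) (auto simp: indicator_def)
      also have "\<dots> \<le> infsum f A"
        using F by (subst nonneg_infsum_complete) (auto intro!: SUP_upper)
      finally show "(\<integral>\<^sup>+x. f x * indicator (F n) x \<partial>count_space A) \<le> infsum f A" .
    qed
    finally show ?thesis .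
  qed
qed

lemma ennreal_infsum_eq_nn_integral:
  fixes f :: "'a \<Rightarrow> real"
  assumes "countable A" "f summable_on A" "\<And>x. x \<in> A \<Longrightarrow> 0 \<le> f x"
  shows "ennreal (infsum f A) = (\<integral>\<^sup>+x. ennreal (f x) \<partial>count_space A)"
proof -
  have "ennreal (infsum f A) = (SUP F\<in>{F. finite F \<and> F \<subseteq> A}. ennreal (sum f F))"
    by (rule infsum_nonneg_is_SUPREMUM_ennreal) (use assms in auto)
  also have "\<dots> = (SUP F\<in>{F. finite F \<and> F \<subseteq> A}. sum (\<lambda>x. ennreal (f x)) F)"
    by (intro SUP_cong) (use assms(3) in \<open>auto intro!: sum_ennreal[symmetric]\<close>)
  also have "\<dots> = infsum (\<lambda>x. ennreal (f x)) A"
    by (subst nonneg_infsum_complete) auto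
  finally show ?thesis
    using assms(1) by (simp add: infsum_ennreal_eq_nn_integral)
qed

text \<open>Dominated convergence for unordered sums along an arbitrary filter: on the set of
  parameters where the majorant holds, the M-test makes the finite partial sums converge uniformly,
  so the two limits may be interchanged.\<close>

lemma infsum_tannery:
  fixes f :: "'a \<Rightarrow> 'b \<Rightarrow> 'c::banach"
  assumes "G \<noteq> bot" and "\<And>k. ((\<lambda>n. f k n) \<longlongrightarrow> b k) G"
    and "\<forall>\<^sub>F n in G. \<forall>k. norm (f k n) \<le> M k" and "M summable_on UNIV"
  shows "((\<lambda>n. \<Sum>\<^sub>\<infinity>k\<in>UNIV. f k n) \<longlongrightarrow> (\<Sum>\<^sub>\<infinity>k\<in>UNIV. b k)) G"
proof -
  define Y where "Y = {n. \<forall>k. norm (f k n) \<le> M k}"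
  have Y: "\<forall>\<^sub>F n in G. n \<in> Y"
    using assms(3) by (simp add: Y_def)
  have U: "uniform_limit Y (\<lambda>X n. \<Sum>k\<in>X. f k n) (\<lambda>n. \<Sum>\<^sub>\<infinity>k\<in>UNIV. f k n) (finite_subsets_at_top UNIV)"
    by (rule Weierstrass_m_test_general[where M = M]) (use assms(4) in \<open>auto simp: Y_def\<close>)
  have "norm (b k) \<le> M k" for k
  proof (rule tendsto_upperbound[OF tendsto_norm[OF assms(2)] _ assms(1)])
    show "\<forall>\<^sub>F n in G. norm (f k n) \<le> M k"
      using assms(3) by (rule eventually_mono) auto
  qed
  then have "(\<lambda>k. norm (b k)) summable_on UNIV"
    by (intro summable_on_comparison_test[OF assms(4)]) auto
  then have "(b has_sum infsum b UNIV) UNIV"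
    by (simp add: abs_summable_summable)
  then have B: "((\<lambda>X. \<Sum>k\<in>X. b k) \<longlongrightarrow> infsum b UNIV) (finite_subsets_at_top UNIV)"
    by (simp add: has_sum_def)
  show ?thesis
    by (rule swap_uniform_limit'[OF _ B U Y]) (use assms(2) in \<open>auto intro!: tendsto_sum\<close>)
qed

text \<open>The supporting line of \<open>y powr p\<close> at \<open>s\<close>. Convexity is used on
  the open half-line, so \<open>y = 0\<close> is computed separately; there the left side equals
  \<open>(1 - p) * s powr p\<close>.\<close>

lemma powr_above_tangent:
  fixes y s p :: real
  assumes "0 \<le> y" "0 < s" "1 \<le> p"
  shows "s powr p + p * s powr (p - 1) * (y - s) \<le> y powr p"
proof (cases "y = 0")
  case True
  have "s powr p = s powr (p - 1) * s"
    using assms(2) by (metis diff_add_cancel less_eq_real_def powr_add powr_one)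
  then have "s powr p + p * s powr (p - 1) * (0 - s) = (1 - p) * s powr p"
    by (simp add: algebra_simps)
  then show ?thesis
    using True assms by (simp add: mult_nonpos_nonneg)
next
  case False
  have D: "((\<lambda>x. x powr p) has_field_derivative p * s powr (p - 1)) (at s within {0<..})"
    by (rule has_field_derivative_at_within, rule has_real_derivative_powr) (rule assms(2))
  have "p * s powr (p - 1) * (y - s) \<le> y powr p - s powr p"
    by (rule convex_on_imp_above_tangent[OF powr_convex[OF assms(3)] _ _ _ D])
       (use assms False in \<open>auto simp: interior_open\<close>)
  then show ?thesis by linarith
qed

text \<open>Jensen's inequality for weights of arbitrary total mass, obtained by summing one tangent
  inequality against the weights. The power \<open>p - 1\<close> of the total mass is what remains
  of normalising the weights.\<close>

lemma infsum_Jensen_powr: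
  fixes x y :: "'a \<Rightarrow> real"
  assumes x: "x summable_on UNIV" "\<And>k. 0 \<le> x k" and y: "\<And>k. 0 \<le> y k" "\<And>k. y k \<le> K" and p: "1 \<le> p"
  shows "(\<Sum>\<^sub>\<infinity>k. x k * y k) powr p \<le> (\<Sum>\<^sub>\<infinity>k. x k) powr (p - 1) * (\<Sum>\<^sub>\<infinity>k. x k * y k powr p)"
proof -
  define X where "X = (\<Sum>\<^sub>\<infinity>k. x k)"
  define Z where "Z = (\<Sum>\<^sub>\<infinity>k. x k * y k)"
  have K: "0 \<le> K" using y order_trans by blast
  have s1: "(\<lambda>k. x k * y k) summable_on UNIV"
    by (rule summable_on_comparison_test[OF summable_on_cmult_left[OF x(1), of K]])
       (use x y in \<open>auto intro!: mult_left_mono\<close>)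
  have s2: "(\<lambda>k. x k * y k powr p) summable_on UNIV"
    by (rule summable_on_comparison_test[OF summable_on_cmult_left[OF x(1), of "K powr p"]])
       (use x y p in \<open>auto intro!: mult_left_mono powr_mono2\<close>)
  have X0: "0 \<le> X" and Z0: "0 \<le> Z"
    using x y by (auto simp: X_def Z_def intro!: infsum_nonneg)
  show ?thesis
  proof (cases "Z = 0")
    case True
    then show ?thesis using p x y by (auto simp: Z_def intro!: mult_nonneg_nonneg infsum_nonneg)
  next
    case False
    then have Zp: "0 < Z" using Z0 by simp
    have "Z \<le> (\<Sum>\<^sub>\<infinity>k. x k * K)"
      unfolding Z_def by (rule infsum_mono[OF s1]) (use x y in \<open>auto intro!: mult_left_mono summable_on_cmult_left\<close>)
    also have "\<dots> = X * K"
      unfolding X_def by (rule infsum_cmult_left) (use x in auto)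
    finally have Xp: "0 < X" using Zp X0 K by (metis less_eq_real_def mult_zero_left not_less)
    \<comment> \<open>The tangent is taken at the weighted mean, so that the linear terms cancel
      after summation, since \<open>Z = X * s\<close>.\<close>
    define s where "s = Z / X"
    have s: "0 < s" using Zp Xp by (simp add: s_def)
    define D where "D = p * s powr (p - 1)"
    define E where "E = s powr p - D * s"
    have sE: "(\<lambda>k. x k * E) summable_on UNIV" and sD: "(\<lambda>k. x k * y k * D) summable_on UNIV"
      using x s1 by (auto intro!: summable_on_cmult_left)
    have "X * s powr p = X * E + Z * D"
      using Xp by (simp add: E_def s_def algebra_simps)
    also have "\<dots> = (\<Sum>\<^sub>\<infinity>k. x k * E + x k * y k * D)"
      unfolding X_def Z_def using sE sD x(1) s1 by (simp add: infsum_add infsum_cmult_left)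
    also have "\<dots> \<le> (\<Sum>\<^sub>\<infinity>k. x k * y k powr p)"
    proof (rule infsum_mono[OF summable_on_add[OF sE sD] s2])
      fix k
      have "x k * (s powr p + D * (y k - s)) \<le> x k * y k powr p"
        unfolding D_def using powr_above_tangent[OF y(1) s p] x(2) by (intro mult_left_mono) auto
      then show "x k * E + x k * y k * D \<le> x k * y k powr p"
        by (simp add: E_def algebra_simps)
    qed
    finally have le: "X * s powr p \<le> (\<Sum>\<^sub>\<infinity>k. x k * y k powr p)" .
    have "X powr p = X powr (p - 1) * X"
      using Xp by (metis diff_add_cancel less_eq_real_def powr_add powr_one)
    then have "Z powr p = X powr (p - 1) * (X * s powr p)"
      using Xp Zp by (simp add: s_def powr_divide)
    also have "\<dots> \<le> X powr (p - 1) * (\<Sum>\<^sub>\<infinity>k. x k * y k powr p)"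
      using le by (intro mult_left_mono) auto
    finally show ?thesis by (simp add: X_def Z_def)
  qed
qed

lemma powr_add_le:
  fixes a b p :: real
  assumes "0 \<le> a" "0 \<le> b" "1 \<le> p"
  shows "(a + b) powr p \<le> 2 powr p * (a powr p + b powr p)"
proof -
  have "(a + b) powr p \<le> (2 * max a b) powr p"
    using assms by (intro powr_mono2) auto
  also have "\<dots> = 2 powr p * max a b powr p"
    using assms by (simp add: powr_mult)
  also have "max a b powr p \<le> a powr p + b powr p"
    by (simp add: max_def)
  finally show ?thesis by simp
qed

section \<open>Trapezoidal cutoffs and the damped envelope\<close>

definition cutoff :: "nat \<Rightarrow> int \<Rightarrow> real" where
  "cutoff R t = max 0 (min 1 (2 - \<bar>real_of_int t\<bar> / real R))"

lemma cutoff_bounds: "0 \<le> cutoff R t" "cutoff R t \<le> 1"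
  by (auto simp: cutoff_def)

lemma cutoff_eq_1:
  assumes "R > 0" "\<bar>t\<bar> \<le> int R"
  shows "cutoff R t = 1"
proof -
  have "\<bar>real_of_int t\<bar> \<le> real R" using assms(2) by linarith
  then show ?thesis using assms by (simp add: cutoff_def divide_le_eq)
qed

lemma cutoff_eq_0:
  assumes "R > 0" "\<not> \<bar>t\<bar> \<le> 2 * int R"
  shows "cutoff R t = 0"
proof -
  have "2 * real R \<le> \<bar>real_of_int t\<bar>" using assms(2) by linarith
  then show ?thesis using assms by (simp add: cutoff_def le_divide_eq)
qed

text \<open>The Lipschitz bound may be multiplied by the number of arguments within distance
  \<open>2 * R\<close> of 0, since the difference vanishes when both lie outside. This factor keeps
  the commutator error local instead of spreading it over all integers.\<close>

lemma cutoff_diff_le: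
  assumes "R > 0"
  shows "\<bar>cutoff R s - cutoff R t\<bar> \<le> min 1 (\<bar>real_of_int (s - t)\<bar> / real R)
    * (of_bool (\<bar>s\<bar> \<le> 2 * int R) + of_bool (\<bar>t\<bar> \<le> 2 * int R))" (is "_ \<le> ?r")
proof -
  have "\<bar>cutoff R s - cutoff R t\<bar> \<le> \<bar>\<bar>real_of_int s\<bar> / real R - \<bar>real_of_int t\<bar> / real R\<bar>"
    unfolding cutoff_def by linarith
  also have "\<dots> = \<bar>\<bar>real_of_int s\<bar> - \<bar>real_of_int t\<bar>\<bar> / real R"
    by (simp add: diff_divide_distrib[symmetric])
  also have "\<dots> \<le> \<bar>real_of_int (s - t)\<bar> / real R"
    by (intro divide_right_mono) auto
  finally have 1: "\<bar>cutoff R s - cutoff R t\<bar> \<le> \<bar>real_of_int (s - t)\<bar> / real R" .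
  have 2: "\<bar>cutoff R s - cutoff R t\<bar> \<le> 1"
    using cutoff_bounds[of R s] cutoff_bounds[of R t] by linarith
  have "\<bar>cutoff R s - cutoff R t\<bar> \<le> min 1 (\<bar>real_of_int (s - t)\<bar> / real R) * 1"
    using 1 2 by simp
  also have "\<dots> \<le> ?r" if "\<bar>s\<bar> \<le> 2 * int R \<or> \<bar>t\<bar> \<le> 2 * int R"
    using that by (intro mult_left_mono) (auto simp: of_bool_def)
  finally show ?thesis
    using cutoff_eq_0[OF assms, of s] cutoff_eq_0[OF assms, of t] by fastforce
qed

text \<open>Majorant of the commutator entries as a function of the distance \<open>t\<close> to the
  diagonal: the envelope of the matrix times the Lipschitz bound of the cutoff.\<close>

definition damp :: "(int \<Rightarrow> real) \<Rightarrow> nat \<Rightarrow> int \<Rightarrow> real" where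
  "damp \<theta> R t = \<theta> t * min 1 (\<bar>real_of_int t\<bar> / real R)"

lemma damp_summable:
  assumes "\<And>t. 0 \<le> \<theta> t" "\<theta> summable_on UNIV"
  shows "damp \<theta> R summable_on UNIV" "0 \<le> damp \<theta> R t"
proof -
  have *: "0 \<le> damp \<theta> R t" "damp \<theta> R t \<le> \<theta> t" for t
    using assms(1)[of t] by (auto simp: damp_def intro: mult_left_le)
  show "damp \<theta> R summable_on UNIV"
    by (rule summable_on_comparison_test[OF assms(2)]) (use * in auto)
  show "0 \<le> damp \<theta> R t" by (rule *)
qed

lemma damp_tendsto_0:
  assumes "\<And>t. 0 \<le> \<theta> t" "\<theta> summable_on UNIV"
  shows "(\<lambda>R. \<Sum>\<^sub>\<infinity>t. damp \<theta> R t) \<longlonglongrightarrow> 0"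
proof -
  have "(\<lambda>R. \<Sum>\<^sub>\<infinity>t\<in>UNIV. damp \<theta> R t) \<longlonglongrightarrow> (\<Sum>\<^sub>\<infinity>t\<in>(UNIV::int set). 0)"
  proof (rule infsum_tannery[where M = \<theta>])
    show "\<forall>\<^sub>F R in sequentially. \<forall>t. norm (damp \<theta> R t) \<le> \<theta> t"
      using assms(1) by (auto simp: damp_def abs_mult intro!: always_eventually mult_left_le)
    fix t
    have "(\<lambda>R. \<bar>real_of_int t\<bar> / real R) \<longlonglongrightarrow> 0"
      by (rule lim_const_over_n)
    then have "(\<lambda>R. \<theta> t * min 1 (\<bar>real_of_int t\<bar> / real R)) \<longlonglongrightarrow> \<theta> t * min 1 0"
      by (intro tendsto_intros)
    then show "(\<lambda>R. damp \<theta> R t) \<longlonglongrightarrow> 0"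
      by (simp add: damp_def)
  qed (use assms in auto)
  then show ?thesis by simp
qed

section \<open>Matrices with summable off-diagonal decay\<close>

definition finsupp :: "(int \<Rightarrow> complex) \<Rightarrow> bool" where
  "finsupp c \<longleftrightarrow> finite {k. c k \<noteq> 0}"

lemma bij_reflect_int: "bij (\<lambda>k. m - k :: int)"
  by (rule bij_betw_byWitness[where f' = "\<lambda>k. m - k"]) auto

lemma nn_integral_int_shift:
  fixes f :: "int \<Rightarrow> ennreal"
  shows "(\<integral>\<^sup>+k. f (k + s) \<partial>count_space UNIV) = (\<integral>\<^sup>+k. f k \<partial>count_space UNIV)"
  by (rule nn_integral_bij_count_space) (rule bij_plus_right)

lemma nn_integral_int_window:
  assumes "0 \<le> r"
  shows "(\<integral>\<^sup>+n. indicator {m - r..m + r} n \<partial>count_space (UNIV::int set)) = ennreal (real_of_int (2 * r + 1))"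
proof -
  have "(\<integral>\<^sup>+n. indicator {m - r..m + r} n \<partial>count_space (UNIV::int set)) = of_nat (card {m - r..m + r})"
    by (simp add: emeasure_count_space)
  also have "\<dots> = ennreal (real_of_int (2 * r + 1))"
    using assms by (simp add: ennreal_of_nat_eq_real_of_nat)
  finally show ?thesis .
qed

text \<open>Finiteness carries the argument: for nonzero \<open>b\<close> the first hypothesis is
  satisfied by \<open>S = top\<close> whatever \<open>a\<close> is. Each application is therefore
  preceded by an a priori bound on \<open>S\<close>.\<close>

lemma ennreal_absorb_half:
  fixes S a b :: ennreal
  assumes "S \<le> a + b * S" "b \<le> ennreal (1/2)" "S < top"
  shows "S \<le> 2 * a"
proof (cases "a = top")
  case True
  then show ?thesis by (simp add: ennreal_mult_top)
next
  case False
  obtain s where s: "S = ennreal s" "0 \<le> s" using assms(3) by (cases S) auto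
  obtain t where t: "a = ennreal t" "0 \<le> t" using False by (cases a) auto
  have "S \<le> a + ennreal (1/2) * S"
    using assms(1,2) by (meson add_left_mono mult_right_mono order_trans zero_le)
  also have "\<dots> = ennreal (t + s / 2)"
  proof -
    have "ennreal (1/2) * S = ennreal (s / 2)"
      unfolding s(1) by (subst ennreal_mult'[symmetric]) auto
    then show ?thesis using s t by (simp add: ennreal_plus)
  qed
  finally have "s \<le> t + s / 2" using s t by (simp add: ennreal_le_iff del: ennreal_plus)
  then have "ennreal s \<le> ennreal (2 * t)" by (intro ennreal_leI) linarith
  then show ?thesis using s t by (simp add: ennreal_mult)
qed

lemma finsupp_cutoff:
  assumes "R > 0"
  shows "finsupp (\<lambda>k. of_real (cutoff R (k - n)) * c k)"
  unfolding finsupp_def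
proof (rule finite_subset)
  show "{k. of_real (cutoff R (k - n)) * c k \<noteq> 0} \<subseteq> {n - 2 * int R..n + 2 * int R}"
  proof
    fix k assume "k \<in> {k. of_real (cutoff R (k - n)) * c k \<noteq> 0}"
    then have "cutoff R (k - n) \<noteq> 0" by auto
    then have "\<bar>k - n\<bar> \<le> 2 * int R" using cutoff_eq_0[OF assms] by blast
    then show "k \<in> {n - 2 * int R..n + 2 * int R}" by auto
  qed
qed simp

lemma window_le_cutoff:
  assumes "R > 0"
  shows "indicator {n - int R..n + int R} k * ennreal (norm (c k) powr p)
    \<le> ennreal (norm (of_real (cutoff R (k - n)) * c k) powr p)"
proof (cases "k \<in> {n - int R..n + int R}")
  case True
  then have "cutoff R (k - n) = 1" by (intro cutoff_eq_1 assms) auto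
  then show ?thesis using True by simp
qed simp

text \<open>The cutoff is 1 on a window of radius \<open>R\<close> but is supported on one of radius
  \<open>2 * R\<close>. Two windows of radius \<open>R\<close>, centred at \<open>n - R\<close> and
  \<open>n + R\<close>, cover the latter, so errors on double windows return to the quantity being
  estimated at the cost of a factor 2.\<close>

lemma indicator_double_window:
  "(indicator {n - 2 * int R..n + 2 * int R} k :: ennreal)
    \<le> indicator {(n - int R) - int R..(n - int R) + int R} k + indicator {(n + int R) - int R..(n + int R) + int R} k"
proof -
  have "k \<in> {(n - int R) - int R..(n - int R) + int R} \<or> k \<in> {(n + int R) - int R..(n + int R) + int R}"
    if "k \<in> {n - 2 * int R..n + 2 * int R}"
    using that by auto
  then show ?thesis
    by (cases "k \<in> {n - 2 * int R..n + 2 * int R}") (auto simp del: atLeastAtMost_iff)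
qed

lemma ennreal_mult_nested:
  assumes "0 \<le> a" "0 \<le> b" "0 \<le> c" "0 \<le> d" "0 \<le> e"
  shows "ennreal a * (ennreal b * (ennreal c * (ennreal d * ennreal e))) = ennreal (a * (b * (c * (d * e))))"
  using assms by (simp add: ennreal_mult)

lemma lp_bounded:
  fixes c :: "int \<Rightarrow> complex"
  assumes p: "1 \<le> p" and s: "(\<lambda>k. norm (c k) powr p) summable_on UNIV"
  shows "\<exists>K. \<forall>k. norm (c k) \<le> K"
proof (intro exI allI)
  fix k
  have "norm (c k) powr p \<le> (\<Sum>\<^sub>\<infinity>k. norm (c k) powr p)"
    using finite_sum_le_infsum[OF s, of "{k}"] by simp
  then have "(norm (c k) powr p) powr (1 / p) \<le> (\<Sum>\<^sub>\<infinity>k. norm (c k) powr p) powr (1 / p)"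
    using p by (intro powr_mono2) auto
  then show "norm (c k) \<le> (\<Sum>\<^sub>\<infinity>k. norm (c k) powr p) powr (1 / p)"
    using p by (simp add: powr_powr)
qed

lemma finsupp_lp:
  assumes "finsupp c"
  shows "(\<lambda>k. norm (c k) powr p) summable_on UNIV"
proof (rule summable_on_cong_neutral[THEN iffD1])
  show "(\<lambda>k. norm (c k) powr p) summable_on {k. c k \<noteq> 0}"
    using assms by (simp add: finsupp_def)
qed auto

lemma finsupp_bounded:
  assumes "finsupp c"
  shows "bounded (range c)"
proof -
  have "finite (insert 0 (c ` {k. c k \<noteq> 0}))" using assms by (simp add: finsupp_def)
  then show ?thesis
    by (rule bounded_subset[OF finite_imp_bounded]) auto
qed

text \<open>Rows are abstract indices placed on the integers by \<open>pos\<close>, and several rows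
  may share a position; \<open>Q\<close> bounds their number, so that sums over rows can be compared
  with sums over positions. In the application a row is a sampling point together with a derivative
  order.\<close>

locale localized_matrix =
  fixes I :: "'i set" and pos :: "'i \<Rightarrow> int" and a :: "'i \<Rightarrow> int \<Rightarrow> complex"
    and \<theta> :: "int \<Rightarrow> real" and Q :: nat
  assumes theta_nonneg: "0 \<le> \<theta> t"
    and theta_summable: "\<theta> summable_on UNIV"
    and entry_le: "i \<in> I \<Longrightarrow> norm (a i k) \<le> \<theta> (pos i - k)"
    and fibre_finite: "finite {i \<in> I. pos i = n}"
    and fibre_card: "card {i \<in> I. pos i = n} \<le> Q"
begin

definition app :: "(int \<Rightarrow> complex) \<Rightarrow> 'i \<Rightarrow> complex" where
  "app c i = (\<Sum>\<^sub>\<infinity>k\<in>UNIV. a i k * c k)"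

text \<open>The class \<open>P\<close> of admissible sequences is a parameter because the
  localisation theorems assume the bound on a smaller class than the one on which they conclude
  it.\<close>

definition lower_lp :: "real \<Rightarrow> ((int \<Rightarrow> complex) \<Rightarrow> bool) \<Rightarrow> bool" where
  "lower_lp p P \<longleftrightarrow> (\<exists>A>0. \<forall>c. P c \<longrightarrow>
     ennreal A * (\<integral>\<^sup>+k. ennreal (norm (c k) powr p) \<partial>count_space UNIV)
       \<le> (\<integral>\<^sup>+i. ennreal (norm (app c i) powr p) \<partial>count_space I))"

text \<open>Quantifying over every bound \<open>M\<close> of the output avoids a real supremum over
  a possibly empty set of rows.\<close>

definition lower_linf :: "((int \<Rightarrow> complex) \<Rightarrow> bool) \<Rightarrow> bool" where
  "lower_linf P \<longleftrightarrow> (\<exists>C>0. \<forall>c M. P c \<longrightarrow> 0 \<le> M \<longrightarrow> (\<forall>i\<in>I. norm (app c i) \<le> M) \<longrightarrow>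
     (\<forall>k. norm (c k) \<le> C * M))"

lemma countable_rows: "countable I"
proof -
  have "I = (\<Union>n. {i \<in> I. pos i = n})" by auto
  moreover have "countable (\<Union>n. {i \<in> I. pos i = n})"
    by (rule countable_UN) (auto intro: countable_finite fibre_finite)
  ultimately show ?thesis by simp
qed

lemma theta_shift_summable: "(\<lambda>k. \<theta> (m - k)) summable_on UNIV"
  by (rule summable_on_reindex_bij_betw[OF bij_reflect_int, THEN iffD2, OF theta_summable])

lemma app_summable:
  assumes "i \<in> I" "\<And>k. norm (c k) \<le> K"
  shows "(\<lambda>k. norm (a i k * c k)) summable_on UNIV"
proof (rule summable_on_comparison_test[OF summable_on_cmult_left[OF theta_shift_summable]])
  fix k
  show "norm (a i k * c k) \<le> \<theta> (pos i - k) * K"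
    using entry_le[OF assms(1)] assms(2) theta_nonneg by (auto simp: norm_mult intro!: mult_mono)
qed auto

text \<open>Tonelli over pairs of a row and a position: each position is hit by at most
  \<open>Q\<close> rows.\<close>

lemma nn_integral_rows_le:
  "(\<integral>\<^sup>+i. F (pos i) \<partial>count_space I) \<le> of_nat Q * (\<integral>\<^sup>+n. F n \<partial>count_space UNIV)"
proof -
  have "(\<integral>\<^sup>+i. F (pos i) \<partial>count_space I)
      = (\<integral>\<^sup>+i. (\<integral>\<^sup>+n. F n * indicator {i \<in> I. pos i = n} i \<partial>count_space UNIV) \<partial>count_space I)"
  proof (rule nn_integral_cong)
    fix i assume "i \<in> space (count_space I)"
    then show "F (pos i) = (\<integral>\<^sup>+n. F n * indicator {i \<in> I. pos i = n} i \<partial>count_space UNIV)"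
      by (subst nn_integral_count_space'[of "{pos i}"]) (auto simp: indicator_def)
  qed
  also have "\<dots> = (\<integral>\<^sup>+n. (\<integral>\<^sup>+i. F n * indicator {i \<in> I. pos i = n} i \<partial>count_space I) \<partial>count_space UNIV)"
    by (rule nn_integral_count_space_nn_integral) auto
  also have "\<dots> \<le> (\<integral>\<^sup>+n. of_nat Q * F n \<partial>count_space UNIV)"
  proof (rule nn_integral_mono)
    fix n
    have "(\<integral>\<^sup>+i. F n * indicator {i \<in> I. pos i = n} i \<partial>count_space I) = of_nat (card {i \<in> I. pos i = n}) * F n"
      using fibre_finite[of n]
      by (subst nn_integral_count_space'[of "{i \<in> I. pos i = n}"]) (auto simp: indicator_def)
    also have "\<dots> \<le> of_nat Q * F n"
      using fibre_card[of n] by (intro mult_right_mono) auto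
    finally show "(\<integral>\<^sup>+i. F n * indicator {i \<in> I. pos i = n} i \<partial>count_space I) \<le> of_nat Q * F n" .
  qed
  also have "\<dots> = of_nat Q * (\<integral>\<^sup>+n. F n \<partial>count_space UNIV)"
    by (rule nn_integral_cmult) simp
  finally show ?thesis .
qed

text \<open>Jensen's inequality with the weight \<open>damp \<theta> R\<close> bounds the commutator of the matrix with the cutoff.\<close>
lemma app_cutoff_le:
  fixes n :: int
  assumes R: "R > 0" and p: "1 \<le> p" and i: "i \<in> I" and c: "\<And>k. norm (c k) \<le> K"
  defines "v \<equiv> \<lambda>k. of_real (cutoff R (k - n)) * c k"
  shows "norm (app v i) powr p \<le> 2 powr p * (indicator {n - 2 * int R..n + 2 * int R} (pos i) * norm (app c i) powr p
    + (\<Sum>\<^sub>\<infinity>t. damp \<theta> R t) powr (p - 1) * 2 powr p *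
      (\<Sum>\<^sub>\<infinity>t. damp \<theta> R t * ((indicator {n - 2 * int R..n + 2 * int R} (pos i)
          + indicator {n - 2 * int R..n + 2 * int R} (pos i - t)) * norm (c (pos i - t)) powr p)))"
proof -
  define W where "W = {n - 2 * int R..n + 2 * int R}"
  define \<psi> where "\<psi> k = cutoff R (k - n)" for k
  define \<epsilon> where "\<epsilon> = (\<Sum>\<^sub>\<infinity>t. damp \<theta> R t)"
  \<comment> \<open>Column \<open>k\<close> is addressed by its distance
    \<open>t = pos i - k\<close> to the diagonal. The indicators are those of
    \<open>cutoff_diff_le\<close>, testing row and column for membership in the double
    window.\<close>
  define y where "y t = (indicator W (pos i) + indicator W (pos i - t)) * norm (c (pos i - t))" for t
  have K: "0 \<le> K" using c[of 0] norm_ge_zero order_trans by blast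
  have W: "of_bool (\<bar>k - n\<bar> \<le> 2 * int R) = (indicator W k :: real)" for k
    by (auto simp: W_def indicator_def)
  have y: "0 \<le> y t" "y t \<le> 2 * K" for t
    unfolding y_def using c[of "pos i - t"] K by (auto simp: indicator_def)
  have d: "damp \<theta> R summable_on UNIV" "\<And>t. 0 \<le> damp \<theta> R t"
    using damp_summable[of \<theta> R] theta_nonneg theta_summable by auto
  have dy: "(\<lambda>t. damp \<theta> R t * y t) summable_on UNIV"
    by (rule summable_on_comparison_test[OF summable_on_cmult_left[OF d(1), of "2 * K"]])
       (use y d in \<open>auto intro!: mult_left_mono\<close>)
  have s: "(\<lambda>k. a i k * c k) summable_on UNIV" "(\<lambda>k. a i k * v k) summable_on UNIV"
  proof -
    show "(\<lambda>k. a i k * c k) summable_on UNIV"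
      by (rule abs_summable_summable, rule app_summable[OF i c])
    have "norm (v k) \<le> K" for k
      unfolding v_def using cutoff_bounds[of R "k - n"] c[of k]
      by (simp add: norm_mult) (metis mult_left_le_one_le norm_ge_zero order_trans)
    then show "(\<lambda>k. a i k * v k) summable_on UNIV"
      by (rule abs_summable_summable[OF app_summable[OF i]])
  qed
  \<comment> \<open>The commutator term: weighting the entries by the cutoff at \<open>k\<close>
    instead of at \<open>pos i\<close> costs exactly the matrix with entries
    \<open>a i k * (\<psi> k - \<psi> (pos i))\<close>.\<close>
  define E where "E = (\<Sum>\<^sub>\<infinity>k\<in>UNIV. a i k * (of_real (\<psi> k - \<psi> (pos i)) * c k))"
  have "app v i = of_real (\<psi> (pos i)) * app c i + E"
  proof -
    have eq: "a i k * (of_real (\<psi> k - \<psi> (pos i)) * c k) = a i k * v k + of_real (- \<psi> (pos i)) * (a i k * c k)" for k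
      by (simp add: v_def \<psi>_def algebra_simps)
    have "E = app v i + (\<Sum>\<^sub>\<infinity>k\<in>UNIV. of_real (- \<psi> (pos i)) * (a i k * c k))"
      unfolding E_def eq app_def by (rule infsum_add[OF s(2) summable_on_cmult_right[OF s(1)]])
    also have "(\<Sum>\<^sub>\<infinity>k\<in>UNIV. of_real (- \<psi> (pos i)) * (a i k * c k)) = of_real (- \<psi> (pos i)) * app c i"
      unfolding app_def by (rule infsum_cmult_right[OF s(1)])
    finally show ?thesis by simp
  qed
  then have "norm (app v i) \<le> norm (of_real (\<psi> (pos i)) * app c i) + norm E"
    by (simp only: norm_triangle_ineq)
  also have "norm (of_real (\<psi> (pos i)) * app c i) = \<psi> (pos i) * norm (app c i)"
    using cutoff_bounds[of R "pos i - n"] by (simp add: norm_mult \<psi>_def)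
  also have "\<psi> (pos i) * norm (app c i) \<le> indicator W (pos i) * norm (app c i)"
    using cutoff_eq_0[OF R, of "pos i - n"] cutoff_bounds[of R "pos i - n"]
    by (intro mult_right_mono) (auto simp: \<psi>_def W[symmetric])
  also have "norm E \<le> (\<Sum>\<^sub>\<infinity>t. damp \<theta> R t * y t)"
  proof -
    have dyk: "(\<lambda>k. damp \<theta> R (pos i - k) * y (pos i - k)) summable_on UNIV"
      using dy summable_on_reindex_bij_betw[OF bij_reflect_int, of "\<lambda>t. damp \<theta> R t * y t" "pos i"] by blast
    have le: "norm (a i k * (of_real (\<psi> k - \<psi> (pos i)) * c k)) \<le> damp \<theta> R (pos i - k) * y (pos i - k)" for k
    proof -
      have "norm (a i k * (of_real (\<psi> k - \<psi> (pos i)) * c k)) = norm (a i k) * (\<bar>\<psi> (pos i) - \<psi> k\<bar> * norm (c k))"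
        by (simp only: norm_mult norm_of_real abs_minus_commute)
      also have "\<dots> \<le> \<theta> (pos i - k) * ((min 1 (\<bar>real_of_int (pos i - k)\<bar> / real R) * (indicator W (pos i) + indicator W k)) * norm (c k))"
        using entry_le[OF i, of k] cutoff_diff_le[OF R, of "pos i - n" "k - n"]
        by (intro mult_mono) (auto simp: \<psi>_def W theta_nonneg)
      also have "\<dots> = damp \<theta> R (pos i - k) * y (pos i - k)"
        by (simp add: damp_def y_def)
      finally show ?thesis .
    qed
    have abs: "(\<lambda>k. norm (a i k * (of_real (\<psi> k - \<psi> (pos i)) * c k))) summable_on UNIV"
      by (rule summable_on_comparison_test[OF dyk le norm_ge_zero])
    have "norm E \<le> (\<Sum>\<^sub>\<infinity>k. damp \<theta> R (pos i - k) * y (pos i - k))"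
      unfolding E_def
      by (rule norm_infsum_le[OF has_sum_infsum[OF abs_summable_summable[OF abs]] has_sum_infsum[OF dyk] le])
    also have "\<dots> = (\<Sum>\<^sub>\<infinity>t. damp \<theta> R t * y t)"
      by (rule infsum_reindex_bij_betw[OF bij_reflect_int])
    finally show ?thesis .
  qed
  finally have "norm (app v i) powr p \<le> (indicator W (pos i) * norm (app c i) + (\<Sum>\<^sub>\<infinity>t. damp \<theta> R t * y t)) powr p"
    using p by (intro powr_mono2) auto
  also have "\<dots> \<le> 2 powr p * ((indicator W (pos i) * norm (app c i)) powr p + (\<Sum>\<^sub>\<infinity>t. damp \<theta> R t * y t) powr p)"
    using p d y by (intro powr_add_le) (auto intro!: infsum_nonneg)
  also have "(indicator W (pos i) * norm (app c i)) powr p = indicator W (pos i) * norm (app c i) powr p"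
    using p by (auto simp: indicator_def)
  also have "(\<Sum>\<^sub>\<infinity>t. damp \<theta> R t * y t) powr p \<le> \<epsilon> powr (p - 1) * (\<Sum>\<^sub>\<infinity>t. damp \<theta> R t * y t powr p)"
    unfolding \<epsilon>_def by (rule infsum_Jensen_powr[OF d(1) d(2) y p])
  also have "(\<Sum>\<^sub>\<infinity>t. damp \<theta> R t * y t powr p)
     \<le> (\<Sum>\<^sub>\<infinity>t. 2 powr p * (damp \<theta> R t * ((indicator W (pos i) + indicator W (pos i - t)) * norm (c (pos i - t)) powr p)))"
  proof (rule infsum_mono)
    \<comment> \<open>The sum of the two indicators is 0, 1 or 2, so its p-th power is at most
      \<open>2 powr p\<close> times itself. This is the second factor \<open>2 powr p\<close> of the
      statement; the first is due to \<open>powr_add_le\<close>.\<close>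
    have yp: "y t powr p \<le> 2 powr p * ((indicator W (pos i) + indicator W (pos i - t)) * norm (c (pos i - t)) powr p)" for t
    proof -
      have "1 \<le> (2::real) powr p" using p by (simp add: ge_one_powr_ge_zero)
      then show ?thesis
        by (auto simp: y_def indicator_def powr_mult mult_le_cancel_right1)
    qed
    then show "damp \<theta> R t * y t powr p \<le> 2 powr p * (damp \<theta> R t * ((indicator W (pos i) + indicator W (pos i - t)) * norm (c (pos i - t)) powr p))" for t
      using mult_left_mono[OF yp[of t] d(2)[of t]] by (simp add: ac_simps)
    show "(\<lambda>t. damp \<theta> R t * y t powr p) summable_on UNIV"
      by (rule summable_on_comparison_test[OF summable_on_cmult_left[OF d(1), of "(2 * K) powr p"]])
         (use y d p in \<open>auto intro!: mult_left_mono powr_mono2\<close>)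
    have b: "(indicator W (pos i) + indicator W (pos i - t)) * norm (c (pos i - t)) powr p \<le> 2 * K powr p" for t
      using c[of "pos i - t"] K p by (intro mult_mono powr_mono2) (auto simp: indicator_def)
    have "(\<lambda>t. damp \<theta> R t * ((indicator W (pos i) + indicator W (pos i - t)) * norm (c (pos i - t)) powr p)) summable_on UNIV"
      by (rule summable_on_comparison_test[OF summable_on_cmult_left[OF d(1), of "2 * K powr p"]])
         (use b d in \<open>auto intro!: mult_left_mono\<close>)
    then show "(\<lambda>t. 2 powr p * (damp \<theta> R t * ((indicator W (pos i) + indicator W (pos i - t)) * norm (c (pos i - t)) powr p))) summable_on UNIV"
      by (rule summable_on_cmult_right)
  qed
  finally show ?thesis
    unfolding W_def[symmetric] \<epsilon>_def[symmetric] infsum_cmult_right'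
    by (simp add: mult_left_mono mult.assoc)
qed

lemma damp_facts: "damp \<theta> R summable_on UNIV" "0 \<le> damp \<theta> R t"
  by (rule damp_summable[OF theta_nonneg theta_summable])+

text \<open>Jensen contributes the factor with exponent \<open>p - 1\<close>, summation over
  positions the other one. For \<open>p = 1\<close> the former is not small, so it is only bounded
  by 1 and the smallness is taken from the latter.\<close>

lemma small_commutator:
  assumes "1 \<le> p" "0 \<le> B"
  obtains R where "R > 0" "B * ((\<Sum>\<^sub>\<infinity>t. damp \<theta> R t) powr (p - 1) * (\<Sum>\<^sub>\<infinity>t. damp \<theta> R t)) \<le> 1 / 2"
proof -
  define \<epsilon> where "\<epsilon> R = (\<Sum>\<^sub>\<infinity>t. damp \<theta> R t)" for R
  have "\<epsilon> \<longlonglongrightarrow> 0"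
    unfolding \<epsilon>_def by (rule damp_tendsto_0) (use theta_nonneg theta_summable in auto)
  then have "\<forall>\<^sub>F R in sequentially. \<epsilon> R < min 1 (1 / (2 * (B + 1)))"
    using assms(2) by (intro order_tendstoD) auto
  \<comment> \<open>Positivity of \<open>R\<close> has to be imposed separately: division by zero
    yields 0, so \<open>damp \<theta> 0\<close> vanishes identically, while the cutoff of scale 0 is
    constantly 1 and localises nothing.\<close>
  then have "\<forall>\<^sub>F R in sequentially. \<epsilon> R < min 1 (1 / (2 * (B + 1))) \<and> R > 0"
    using eventually_gt_at_top eventually_conj by blast
  then obtain R where R: "\<epsilon> R < min 1 (1 / (2 * (B + 1)))" "R > 0"
    using eventually_happens'[OF sequentially_bot] by blast
  have e0: "0 \<le> \<epsilon> R"
    unfolding \<epsilon>_def using damp_facts by (auto intro: infsum_nonneg)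
  have "\<epsilon> R powr (p - 1) \<le> 1"
    using e0 R assms(1) by (intro powr_le1) auto
  then have "B * (\<epsilon> R powr (p - 1) * \<epsilon> R) \<le> B * (1 * \<epsilon> R)"
    using e0 assms(2) by (intro mult_left_mono mult_right_mono) auto
  also have "\<dots> \<le> (B + 1) * \<epsilon> R"
    using e0 by (simp add: algebra_simps)
  also have "\<dots> \<le> (B + 1) * (1 / (2 * (B + 1)))"
    using R assms(2) by (intro mult_left_mono) auto
  also have "\<dots> = 1 / 2"
    using assms(2) by (simp add: field_simps)
  finally show thesis
    using that R(2) unfolding \<epsilon>_def by blast
qed

text \<open>The commutator estimate in extended nonnegative reals, where sums over rows, positions
  and distances can be exchanged without checking summability.\<close>

lemma app_cutoff_le_ennreal:
  fixes n :: int
  assumes "R > 0" "1 \<le> p" "i \<in> I" "\<And>k. norm (c k) \<le> K"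
  shows "ennreal (norm (app (\<lambda>k. of_real (cutoff R (k - n)) * c k) i) powr p)
    \<le> ennreal (2 powr p) * (indicator {n - 2 * int R..n + 2 * int R} (pos i) * ennreal (norm (app c i) powr p))
      + ennreal (2 powr p * (\<Sum>\<^sub>\<infinity>t. damp \<theta> R t) powr (p - 1) * 2 powr p) *
      (\<integral>\<^sup>+t. ennreal (damp \<theta> R t) * ((indicator {n - 2 * int R..n + 2 * int R} (pos i)
          + indicator {n - 2 * int R..n + 2 * int R} (pos i - t)) * ennreal (norm (c (pos i - t)) powr p))
        \<partial>count_space UNIV)"
    (is "_ \<le> ennreal (2 powr p) * (indicator ?W (pos i) * ennreal ?x) + ennreal ?C * ?J")
proof -
  define F where "F t = damp \<theta> R t * ((indicator ?W (pos i) + indicator ?W (pos i - t)) * norm (c (pos i - t)) powr p)" for t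
  have K: "0 \<le> K" using assms(4)[of 0] norm_ge_zero order_trans by blast
  have F0: "0 \<le> F t" for t
    unfolding F_def using damp_facts by auto
  have "(indicator ?W (pos i) + indicator ?W (pos i - t)) * norm (c (pos i - t)) powr p \<le> 2 * K powr p" for t
    using assms(4)[of "pos i - t"] K assms(2) by (intro mult_mono powr_mono2) (auto simp: indicator_def)
  then have Fs: "F summable_on UNIV"
    by (intro summable_on_comparison_test[OF summable_on_cmult_left[OF damp_facts(1)[of R], of "2 * K powr p"]] F0)
       (auto simp: F_def damp_facts intro!: mult_left_mono)
  have J: "?J = ennreal (infsum F UNIV)"
    by (subst ennreal_infsum_eq_nn_integral[OF _ Fs F0])
       (auto simp: F_def ennreal_mult ennreal_plus damp_facts indicator_def intro!: nn_integral_cong)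
  have "norm (app (\<lambda>k. of_real (cutoff R (k - n)) * c k) i) powr p
      \<le> 2 powr p * (indicator ?W (pos i) * ?x + (\<Sum>\<^sub>\<infinity>t. damp \<theta> R t) powr (p - 1) * 2 powr p * infsum F UNIV)"
    unfolding F_def by (rule app_cutoff_le[OF assms])
  also have "\<dots> = 2 powr p * (indicator ?W (pos i) * ?x) + ?C * infsum F UNIV"
    by (simp add: algebra_simps)
  finally have "ennreal (norm (app (\<lambda>k. of_real (cutoff R (k - n)) * c k) i) powr p)
      \<le> ennreal (2 powr p * (indicator ?W (pos i) * ?x) + ?C * infsum F UNIV)"
    by (rule ennreal_leI)
  also have "\<dots> = ennreal (2 powr p * (indicator ?W (pos i) * ?x)) + ennreal (?C * infsum F UNIV)"
    by (intro ennreal_plus mult_nonneg_nonneg infsum_nonneg F0) auto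
  also have "ennreal (?C * infsum F UNIV) = ennreal ?C * ?J"
    unfolding J by (intro ennreal_mult) (auto intro!: infsum_nonneg F0)
  also have "ennreal (2 powr p * (indicator ?W (pos i) * ?x)) = ennreal (2 powr p) * (indicator ?W (pos i) * ennreal ?x)"
    by (subst ennreal_mult) (auto simp: indicator_def)
  finally show ?thesis .
qed

lemma nn_integral_damp: "(\<integral>\<^sup>+t. ennreal (damp \<theta> R t) \<partial>count_space UNIV) = ennreal (\<Sum>\<^sub>\<infinity>t. damp \<theta> R t)"
  by (rule ennreal_infsum_eq_nn_integral[OF _ damp_facts(1) damp_facts(2), symmetric]) simp

text \<open>The quantity estimated is \<open>S\<close>, the supremum over all windows of the local
  p-th power sum of \<open>c\<close>, which is finite since \<open>c\<close> is bounded. The lower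
  bound for the cut-off sequence controls each window sum by the outputs near that window, at most
  \<open>M\<close> each, plus a small multiple of \<open>S\<close>.\<close>

theorem lower_lp_imp_lower_linf:
  assumes p: "1 \<le> p" and "lower_lp p finsupp"
  shows "lower_linf (\<lambda>c. bounded (range c))"
proof -
  obtain A where A: "A > 0" and low: "\<And>c. finsupp c \<Longrightarrow>
     ennreal A * (\<integral>\<^sup>+k. ennreal (norm (c k) powr p) \<partial>count_space UNIV)
       \<le> (\<integral>\<^sup>+i. ennreal (norm (app c i) powr p) \<partial>count_space I)"
    using assms(2) by (auto simp: lower_lp_def)
  \<comment> \<open>The coefficient of the commutator error: \<open>1 / A\<close> inverts the lower
    bound, the two powers of 2 come from the commutator estimate, \<open>Q\<close> counts rows per
    position, and 4 stands for two indicators, each costing two windows of radius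
    \<open>R\<close>.\<close>
  define B where "B = 1 / A * (2 powr p * 2 powr p * real Q * 4)"
  obtain R where R: "R > 0" and small: "B * ((\<Sum>\<^sub>\<infinity>t. damp \<theta> R t) powr (p - 1) * (\<Sum>\<^sub>\<infinity>t. damp \<theta> R t)) \<le> 1 / 2"
    using small_commutator[OF p, of B] A by (auto simp: B_def)
  define \<epsilon> where "\<epsilon> = (\<Sum>\<^sub>\<infinity>t. damp \<theta> R t)"
  have e0: "0 \<le> \<epsilon>" unfolding \<epsilon>_def using damp_facts by (auto intro: infsum_nonneg)
  \<comment> \<open>The leading 2 comes from the absorption, \<open>4 * R + 1\<close> is the number
    of positions in a double window, and the final 1 keeps \<open>D\<close> positive even if
    \<open>Q = 0\<close>.\<close>
  define D where "D = 2 * (1 / A * (2 powr p * (real Q * (4 * real R + 1)))) + 1"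
  have D: "D > 0" using A by (auto simp: D_def intro!: add_nonneg_pos)
  have main: "norm (c k) \<le> D powr (1 / p) * M"
    if c: "\<And>k. norm (c k) \<le> K" and M: "0 \<le> M" "\<And>i. i \<in> I \<Longrightarrow> norm (app c i) \<le> M" for c M K k
  proof -
    define u where "u k = ennreal (norm (c k) powr p)" for k
    define X where "X n = (\<integral>\<^sup>+k. indicator {n - int R..n + int R} k * u k \<partial>count_space UNIV)" for n
    define S where "S = (SUP n. X n)"
    have K: "0 \<le> K" using c[of 0] norm_ge_zero order_trans by blast
    have X: "X n \<le> S" for n unfolding S_def by (rule SUP_upper) simp
    have "X n \<le> ennreal (K powr p) * ennreal (real_of_int (2 * int R + 1))" for n
    proof -
      have "X n \<le> (\<integral>\<^sup>+k. ennreal (K powr p) * indicator {n - int R..n + int R} k \<partial>count_space UNIV)"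
        unfolding X_def u_def using c p
        by (intro nn_integral_mono) (auto simp: indicator_def intro!: ennreal_leI powr_mono2)
      also have "\<dots> = ennreal (K powr p) * ennreal (real_of_int (2 * int R + 1))"
        by (subst nn_integral_cmult) (auto simp: nn_integral_int_window simp del: nn_integral_indicator)
      finally show ?thesis .
    qed
    then have "S \<le> ennreal (K powr p) * ennreal (real_of_int (2 * int R + 1))"
      unfolding S_def by (rule SUP_least)
    then have S_fin: "S < top"
      by (metis ennreal_less_top ennreal_mult_less_top order_le_less_trans)
    have W2: "(\<integral>\<^sup>+k. indicator {n - 2 * int R..n + 2 * int R} k * u k \<partial>count_space UNIV) \<le> 2 * S" for n
    proof -
      have "(\<integral>\<^sup>+k. indicator {n - 2 * int R..n + 2 * int R} k * u k \<partial>count_space UNIV)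
        \<le> (\<integral>\<^sup>+k. indicator {(n - int R) - int R..(n - int R) + int R} k * u k
             + indicator {(n + int R) - int R..(n + int R) + int R} k * u k \<partial>count_space UNIV)"
        by (intro nn_integral_mono) (unfold distrib_right[symmetric], intro mult_right_mono indicator_double_window, simp)
      also have "\<dots> = X (n - int R) + X (n + int R)"
        unfolding X_def by (rule nn_integral_add) auto
      also have "\<dots> \<le> 2 * S"
        unfolding mult_2 by (intro add_mono X)
      finally show ?thesis .
    qed
    \<comment> \<open>After exchanging the sums and substituting \<open>m = k + t\<close>, the
      condition on the row becomes a double window around \<open>n - t\<close> for the column. As
      \<open>S\<close> is a supremum over all centres, this translation costs nothing.\<close>
    have Fsum: "(\<integral>\<^sup>+m. (\<integral>\<^sup>+t. ennreal (damp \<theta> R t) * ((indicator {n - 2 * int R..n + 2 * int R} m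
          + indicator {n - 2 * int R..n + 2 * int R} (m - t)) * u (m - t)) \<partial>count_space UNIV) \<partial>count_space UNIV)
        \<le> ennreal \<epsilon> * (4 * S)" for n
    proof -
      let ?W = "{n - 2 * int R..n + 2 * int R}"
      have "(\<integral>\<^sup>+m. (\<integral>\<^sup>+t. ennreal (damp \<theta> R t) * ((indicator ?W m + indicator ?W (m - t)) * u (m - t)) \<partial>count_space UNIV) \<partial>count_space UNIV)
        = (\<integral>\<^sup>+t. (\<integral>\<^sup>+m. ennreal (damp \<theta> R t) * ((indicator ?W m + indicator ?W (m - t)) * u (m - t)) \<partial>count_space UNIV) \<partial>count_space UNIV)"
        by (rule nn_integral_count_space_nn_integral) auto
      also have "\<dots> \<le> (\<integral>\<^sup>+t. ennreal (damp \<theta> R t) * (4 * S) \<partial>count_space UNIV)"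
      proof (rule nn_integral_mono)
        fix t
        have "(\<integral>\<^sup>+m. (indicator ?W m + indicator ?W (m - t)) * u (m - t) \<partial>count_space UNIV)
          = (\<integral>\<^sup>+k. (indicator ?W (k + t) + indicator ?W k) * u k \<partial>count_space UNIV)"
          using nn_integral_int_shift[of "\<lambda>m. (indicator ?W m + indicator ?W (m - t)) * u (m - t)" t] by simp
        also have "\<dots> = (\<integral>\<^sup>+k. indicator {(n - t) - 2 * int R..(n - t) + 2 * int R} k * u k + indicator ?W k * u k \<partial>count_space UNIV)"
        proof (rule nn_integral_cong)
          fix k
          have "(indicator ?W (k + t) :: ennreal) = indicator {(n - t) - 2 * int R..(n - t) + 2 * int R} k"
            by (auto simp: indicator_def)
          then show "(indicator ?W (k + t) + indicator ?W k) * u k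
              = indicator {(n - t) - 2 * int R..(n - t) + 2 * int R} k * u k + indicator ?W k * u k"
            by (simp only: distrib_right)
        qed
        also have "\<dots> = (\<integral>\<^sup>+k. indicator {(n - t) - 2 * int R..(n - t) + 2 * int R} k * u k \<partial>count_space UNIV)
            + (\<integral>\<^sup>+k. indicator ?W k * u k \<partial>count_space UNIV)"
          by (rule nn_integral_add) auto
        also have "\<dots> \<le> 2 * S + 2 * S"
          by (intro add_mono W2)
        also have "\<dots> = 4 * S" by (simp add: distrib_right[symmetric])
        finally show "(\<integral>\<^sup>+m. ennreal (damp \<theta> R t) * ((indicator ?W m + indicator ?W (m - t)) * u (m - t)) \<partial>count_space UNIV)
            \<le> ennreal (damp \<theta> R t) * (4 * S)"
          by (subst nn_integral_cmult) (auto intro!: mult_left_mono)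
      qed
      also have "\<dots> = ennreal \<epsilon> * (4 * S)"
        by (subst nn_integral_multc) (auto simp: nn_integral_damp \<epsilon>_def)
      finally show ?thesis .
    qed
    define E0 where "E0 = ennreal (1 / A * (2 powr p * (real Q * (4 * real R + 1))) * M powr p)"
    define C2 where "C2 = 2 powr p * \<epsilon> powr (p - 1) * 2 powr p"
    have Xle: "X n \<le> E0 + ennreal (B * (\<epsilon> powr (p - 1) * \<epsilon>)) * S" for n
    proof -
      let ?W = "{n - 2 * int R..n + 2 * int R}"
      let ?v = "\<lambda>k. of_real (cutoff R (k - n)) * c k"
      define F where "F m = (\<integral>\<^sup>+t. ennreal (damp \<theta> R t) * ((indicator ?W m + indicator ?W (m - t)) * u (m - t)) \<partial>count_space UNIV)" for m
      have "ennreal A * X n \<le> ennreal A * (\<integral>\<^sup>+k. ennreal (norm (?v k) powr p) \<partial>count_space UNIV)"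
        unfolding X_def u_def by (intro mult_left_mono nn_integral_mono window_le_cutoff R) auto
      also have "\<dots> \<le> (\<integral>\<^sup>+i. ennreal (norm (app ?v i) powr p) \<partial>count_space I)"
        by (rule low[OF finsupp_cutoff[OF R]])
      also have "\<dots> \<le> (\<integral>\<^sup>+i. ennreal (2 powr p) * (ennreal (M powr p) * indicator ?W (pos i)) + ennreal C2 * F (pos i) \<partial>count_space I)"
      proof (rule nn_integral_mono)
        fix i assume "i \<in> space (count_space I)"
        then have i: "i \<in> I" by simp
        have "ennreal (norm (app ?v i) powr p) \<le> ennreal (2 powr p) * (indicator ?W (pos i) * ennreal (norm (app c i) powr p)) + ennreal C2 * F (pos i)"
          unfolding C2_def F_def u_def \<epsilon>_def by (rule app_cutoff_le_ennreal[OF R p i c])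
        also have "\<dots> \<le> ennreal (2 powr p) * (ennreal (M powr p) * indicator ?W (pos i)) + ennreal C2 * F (pos i)"
          using M(2)[OF i] p
          by (intro add_right_mono mult_left_mono) (auto simp: indicator_def intro!: ennreal_leI powr_mono2)
        finally show "ennreal (norm (app ?v i) powr p) \<le> \<dots>" .
      qed
      also have "\<dots> = ennreal (2 powr p) * (ennreal (M powr p) * (\<integral>\<^sup>+i. indicator ?W (pos i) \<partial>count_space I)) + ennreal C2 * (\<integral>\<^sup>+i. F (pos i) \<partial>count_space I)"
        by (simp add: nn_integral_add nn_integral_cmult)
      also have "\<dots> \<le> ennreal (2 powr p) * (ennreal (M powr p) * (of_nat Q * ennreal (4 * real R + 1))) + ennreal C2 * (of_nat Q * (ennreal \<epsilon> * (4 * S)))"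
      proof -
        have "(\<integral>\<^sup>+i. indicator ?W (pos i) \<partial>count_space I) \<le> of_nat Q * (\<integral>\<^sup>+m. indicator ?W m \<partial>count_space UNIV)"
          by (rule nn_integral_rows_le)
        also have "(\<integral>\<^sup>+m. indicator ?W m \<partial>count_space UNIV) = ennreal (4 * real R + 1)"
          by (subst nn_integral_int_window) auto
        finally have 1: "(\<integral>\<^sup>+i. indicator ?W (pos i) \<partial>count_space I) \<le> of_nat Q * ennreal (4 * real R + 1)" .
        have "(\<integral>\<^sup>+i. F (pos i) \<partial>count_space I) \<le> of_nat Q * (\<integral>\<^sup>+m. F m \<partial>count_space UNIV)"
          by (rule nn_integral_rows_le)
        also have "\<dots> \<le> of_nat Q * (ennreal \<epsilon> * (4 * S))"
          unfolding F_def by (intro mult_left_mono Fsum) auto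
        finally have 2: "(\<integral>\<^sup>+i. F (pos i) \<partial>count_space I) \<le> of_nat Q * (ennreal \<epsilon> * (4 * S))" .
        show ?thesis by (intro add_mono mult_left_mono 1 2) auto
      qed
      finally have "ennreal (1 / A) * (ennreal A * X n) \<le> ennreal (1 / A) * \<dots>"
        by (rule mult_left_mono) simp
      moreover have "ennreal (1 / A) * (ennreal A * X n) = X n"
        using A by (simp add: mult.assoc[symmetric] ennreal_mult[symmetric])
      moreover have "ennreal (1 / A) * (ennreal (2 powr p) * (ennreal (M powr p) * (of_nat Q * ennreal (4 * real R + 1))) + ennreal C2 * (of_nat Q * (ennreal \<epsilon> * (4 * S))))
         = E0 + ennreal (B * (\<epsilon> powr (p - 1) * \<epsilon>)) * S"
      proof -
        have "1 / A * (2 powr p * (real Q * (4 * real R + 1))) * M powr p = 1 / A * (2 powr p * (M powr p * (real Q * (4 * real R + 1))))"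
          by (simp only: ac_simps)
        then have "ennreal (1 / A) * (ennreal (2 powr p) * (ennreal (M powr p) * (of_nat Q * ennreal (4 * real R + 1)))) = E0"
          unfolding E0_def ennreal_of_nat_eq_real_of_nat using A by (subst ennreal_mult_nested) auto
        moreover have "ennreal (1 / A) * (ennreal C2 * (of_nat Q * (ennreal \<epsilon> * (4 * S)))) = ennreal (B * (\<epsilon> powr (p - 1) * \<epsilon>)) * S"
        proof -
          have "ennreal (B * (\<epsilon> powr (p - 1) * \<epsilon>)) = ennreal (1 / A) * (ennreal C2 * (of_nat Q * (ennreal \<epsilon> * ennreal 4)))"
          proof -
            have "B * (\<epsilon> powr (p - 1) * \<epsilon>) = 1 / A * (C2 * (real Q * (\<epsilon> * 4)))"
              unfolding B_def C2_def by (simp only: ac_simps)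
            moreover have "0 \<le> C2" by (simp add: C2_def)
            ultimately show ?thesis
              unfolding ennreal_of_nat_eq_real_of_nat using A e0 by (subst ennreal_mult_nested) auto
          qed
          then show ?thesis by (simp add: mult.assoc)
        qed
        ultimately show ?thesis by (simp add: distrib_left)
      qed
      ultimately show ?thesis by simp
    qed
    have "S \<le> E0 + ennreal (B * (\<epsilon> powr (p - 1) * \<epsilon>)) * S"
      by (subst S_def) (rule SUP_least, rule Xle)
    then have "S \<le> 2 * E0"
      by (rule ennreal_absorb_half) (use small S_fin in \<open>auto simp: \<epsilon>_def intro!: ennreal_leI simp del: ennreal_half\<close>)
    have "ennreal (norm (c k) powr p) = indicator {k - int R..k + int R} k * u k"
      by (simp add: u_def)
    also have "\<dots> \<le> X k"
      unfolding X_def by (rule nn_integral_ge_point) simp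
    also have "\<dots> \<le> 2 * E0"
      using X \<open>S \<le> 2 * E0\<close> order_trans by blast
    also have "\<dots> \<le> ennreal (D * M powr p)"
    proof -
      have "2 * E0 = ennreal (2 * (1 / A * (2 powr p * (real Q * (4 * real R + 1))) * M powr p))"
        using A unfolding E0_def by (subst ennreal_mult) auto
      also have "\<dots> \<le> ennreal (D * M powr p)"
        unfolding D_def by (intro ennreal_leI) (simp add: algebra_simps)
      finally show ?thesis .
    qed
    finally have "norm (c k) powr p \<le> D * M powr p"
      using D by (simp add: ennreal_le_iff)
    then have "(norm (c k) powr p) powr (1 / p) \<le> (D * M powr p) powr (1 / p)"
      using p by (intro powr_mono2) auto
    then show ?thesis
      using p M D by (simp add: powr_powr powr_mult)
  qed
  show ?thesis
    unfolding lower_linf_def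
  proof (intro exI[of _ "D powr (1 / p)"] conjI allI impI)
    show "0 < D powr (1 / p)" using D by simp
    fix c M k assume "bounded (range c)" "0 \<le> M" "\<forall>i\<in>I. norm (app c i) \<le> M"
    moreover then obtain K where "\<And>k. norm (c k) \<le> K"
      by (auto simp: bounded_iff)
    ultimately show "norm (c k) \<le> D powr (1 / p) * M"
      using main[of c K M k] by blast
  qed
qed

text \<open>The sup-norm bound rewritten for p-th powers. The bound \<open>Z\<close> may be
  infinite, because in the application it contains a sum over rows not known to converge; then the
  right side is infinite, as \<open>C > 0\<close>.\<close>

lemma lower_linf_ennreal:
  assumes p: "1 \<le> p" and C: "C > 0"
    and stab: "\<And>M k. 0 \<le> M \<Longrightarrow> (\<forall>i\<in>I. norm (app v i) \<le> M) \<Longrightarrow> norm (v k) \<le> C * M"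
    and Z: "\<And>i. i \<in> I \<Longrightarrow> ennreal (norm (app v i) powr p) \<le> Z"
  shows "ennreal (norm (v k) powr p) \<le> ennreal (C powr p) * Z"
proof (cases Z)
  case (real z)
  have "norm (app v i) \<le> z powr (1 / p)" if "i \<in> I" for i
  proof -
    have "norm (app v i) powr p \<le> z"
      using Z[OF that] real by (simp add: ennreal_le_iff)
    then have "(norm (app v i) powr p) powr (1 / p) \<le> z powr (1 / p)"
      using p by (intro powr_mono2) auto
    then show ?thesis using p by (simp add: powr_powr)
  qed
  then have "norm (v k) \<le> C * z powr (1 / p)"
    by (intro stab) auto
  then have "norm (v k) powr p \<le> (C * z powr (1 / p)) powr p"
    using p by (intro powr_mono2) auto
  also have "\<dots> = C powr p * z"
    using p C real by (simp add: powr_mult powr_powr)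
  finally have "ennreal (norm (v k) powr p) \<le> ennreal (C powr p * z)"
    by (rule ennreal_leI)
  then show ?thesis using real by (simp add: ennreal_mult)
next
  case top
  then show ?thesis using C by (simp add: ennreal_mult_top)
qed

text \<open>Sum and supremum exchange roles: each window carries the supremum of the p-th powers,
  and \<open>S\<close> sums these over all centres. It is finite because every index lies in
  \<open>2 * R + 1\<close> windows and \<open>c\<close> is p-summable. The sup-norm bounds for the
  cut-off sequences are summed over the centres, and the commutator error is again a small multiple
  of \<open>S\<close>.\<close>

theorem lower_linf_imp_lower_lp:
  assumes p: "1 \<le> p" and "lower_linf finsupp"
  shows "lower_lp p (\<lambda>c. (\<lambda>k. norm (c k) powr p) summable_on UNIV)"
proof -
  obtain C where C: "C > 0" and stab: "\<And>c M k. finsupp c \<Longrightarrow> 0 \<le> M \<Longrightarrow> (\<forall>i\<in>I. norm (app c i) \<le> M) \<Longrightarrow> norm (c k) \<le> C * M"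
    using assms(2) by (auto simp: lower_linf_def)
  define B where "B = C powr p * (2 powr p * 2 powr p * 4)"
  obtain R where R: "R > 0" and small: "B * ((\<Sum>\<^sub>\<infinity>t. damp \<theta> R t) powr (p - 1) * (\<Sum>\<^sub>\<infinity>t. damp \<theta> R t)) \<le> 1 / 2"
    using small_commutator[OF p, of B] by (auto simp: B_def)
  define \<epsilon> where "\<epsilon> = (\<Sum>\<^sub>\<infinity>t. damp \<theta> R t)"
  have e0: "0 \<le> \<epsilon>" unfolding \<epsilon>_def using damp_facts by (auto intro: infsum_nonneg)
  define D where "D = 2 * (C powr p * (2 powr p * (4 * real R + 1)))"
  have D: "D > 0" using C by (auto simp: D_def intro!: mult_pos_pos)
  have main: "(\<integral>\<^sup>+k. ennreal (norm (c k) powr p) \<partial>count_space UNIV)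
      \<le> ennreal D * (\<integral>\<^sup>+i. ennreal (norm (app c i) powr p) \<partial>count_space I)"
    if s: "(\<lambda>k. norm (c k) powr p) summable_on UNIV" for c
  proof -
    obtain K where c: "\<And>k. norm (c k) \<le> K" using lp_bounded[OF p s] by blast
    define u where "u k = ennreal (norm (c k) powr p)" for k
    define X where "X n = (SUP k. indicator {n - int R..n + int R} k * u k)" for n
    define V where "V n = (SUP k. indicator {n - 2 * int R..n + 2 * int R} k * u k)" for n
    define S where "S = (\<integral>\<^sup>+n. X n \<partial>count_space UNIV)"
    define Y where "Y = (\<integral>\<^sup>+i. ennreal (norm (app c i) powr p) \<partial>count_space I)"
    \<comment> \<open>The supremum of the outputs near a window is replaced by their sum. Up to a
      constant this loses nothing after summation over \<open>n\<close>, since each row is counted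
      \<open>4 * R + 1\<close> times.\<close>
    define b where "b n = (\<integral>\<^sup>+i. indicator {n - 2 * int R..n + 2 * int R} (pos i) * ennreal (norm (app c i) powr p) \<partial>count_space I)" for n
    define C2 where "C2 = 2 powr p * \<epsilon> powr (p - 1) * 2 powr p"
    define Z where "Z n = ennreal (2 powr p) * b n + ennreal C2 * (\<integral>\<^sup>+t. ennreal (damp \<theta> R t) * (V (n - t) + V n) \<partial>count_space UNIV)" for n
    have "S \<le> (\<integral>\<^sup>+n. (\<integral>\<^sup>+k. indicator {n - int R..n + int R} k * u k \<partial>count_space UNIV) \<partial>count_space UNIV)"
      unfolding S_def X_def by (intro nn_integral_mono SUP_least nn_integral_ge_point) simp
    also have "\<dots> = (\<integral>\<^sup>+k. (\<integral>\<^sup>+n. indicator {n - int R..n + int R} k * u k \<partial>count_space UNIV) \<partial>count_space UNIV)"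
      by (rule nn_integral_count_space_nn_integral) auto
    also have "\<dots> = (\<integral>\<^sup>+k. ennreal (2 * real R + 1) * u k \<partial>count_space UNIV)"
    proof (rule nn_integral_cong)
      fix k :: int
      have "(\<integral>\<^sup>+n. indicator {n - int R..n + int R} k * u k \<partial>count_space UNIV)
          = (\<integral>\<^sup>+n. indicator {k - int R..k + int R} n * u k \<partial>count_space UNIV)"
        by (intro nn_integral_cong arg_cong2[where f = "(*)"]) (auto simp: indicator_def)
      also have "\<dots> = (\<integral>\<^sup>+n. indicator {k - int R..k + int R} n \<partial>count_space UNIV) * u k"
        by (rule nn_integral_multc) simp
      finally show "(\<integral>\<^sup>+n. indicator {n - int R..n + int R} k * u k \<partial>count_space UNIV) = ennreal (2 * real R + 1) * u k"
        by (subst (asm) nn_integral_int_window) auto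
    qed
    also have "\<dots> = ennreal (2 * real R + 1) * ennreal (\<Sum>\<^sub>\<infinity>k. norm (c k) powr p)"
      unfolding u_def by (subst nn_integral_cmult) (auto simp: ennreal_infsum_eq_nn_integral[OF _ s])
    finally have S_fin: "S < top"
      by (metis ennreal_less_top ennreal_mult_less_top order_le_less_trans)
    have V: "V n \<le> X (n - int R) + X (n + int R)" for n
      unfolding V_def
    proof (rule SUP_least)
      fix k
      have "indicator {n - 2 * int R..n + 2 * int R} k * u k
        \<le> (indicator {(n - int R) - int R..(n - int R) + int R} k + indicator {(n + int R) - int R..(n + int R) + int R} k) * u k"
        by (intro mult_right_mono indicator_double_window) simp
      also have "\<dots> \<le> X (n - int R) + X (n + int R)"
        unfolding X_def distrib_right by (intro add_mono SUP_upper) auto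
      finally show "indicator {n - 2 * int R..n + 2 * int R} k * u k \<le> \<dots>" .
    qed
    have Xshift: "(\<integral>\<^sup>+n. X (n + s) \<partial>count_space UNIV) = S" for s
      unfolding S_def by (rule nn_integral_int_shift)
    have V2: "(\<integral>\<^sup>+n. V n \<partial>count_space UNIV) \<le> 2 * S"
    proof -
      have "(\<integral>\<^sup>+n. V n \<partial>count_space UNIV) \<le> (\<integral>\<^sup>+n. X (n + - int R) + X (n + int R) \<partial>count_space UNIV)"
        using V by (intro nn_integral_mono) simp
      also have "\<dots> = (\<integral>\<^sup>+n. X (n + - int R) \<partial>count_space UNIV) + (\<integral>\<^sup>+n. X (n + int R) \<partial>count_space UNIV)"
        by (rule nn_integral_add) auto
      also have "\<dots> = 2 * S" unfolding Xshift mult_2 ..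
      finally show ?thesis .
    qed
    have Xle: "X n \<le> ennreal (C powr p) * Z n" for n
      unfolding X_def
    proof (rule SUP_least)
      fix k
      let ?v = "\<lambda>k. of_real (cutoff R (k - n)) * c k"
      let ?W = "{n - 2 * int R..n + 2 * int R}"
      have "indicator {n - int R..n + int R} k * u k \<le> ennreal (norm (?v k) powr p)"
        unfolding u_def by (rule window_le_cutoff[OF R])
      also have "\<dots> \<le> ennreal (C powr p) * Z n"
      proof (rule lower_linf_ennreal[OF p C])
        show "norm (?v k) \<le> C * M" if "0 \<le> M" "\<forall>i\<in>I. norm (app ?v i) \<le> M" for M k
          by (rule stab[OF finsupp_cutoff[OF R] that])
        fix i assume i: "i \<in> I"
        have "ennreal (norm (app ?v i) powr p) \<le> ennreal (2 powr p) * (indicator ?W (pos i) * ennreal (norm (app c i) powr p))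
          + ennreal C2 * (\<integral>\<^sup>+t. ennreal (damp \<theta> R t) * ((indicator ?W (pos i) + indicator ?W (pos i - t)) * u (pos i - t)) \<partial>count_space UNIV)"
          unfolding C2_def u_def \<epsilon>_def by (rule app_cutoff_le_ennreal[OF R p i c])
        also have "\<dots> \<le> Z n"
          unfolding Z_def
        proof (intro add_mono mult_left_mono nn_integral_mono)
          show "indicator ?W (pos i) * ennreal (norm (app c i) powr p) \<le> b n"
            unfolding b_def by (rule nn_integral_ge_point[of i I "\<lambda>i. indicator ?W (pos i) * ennreal (norm (app c i) powr p)"]) (rule i)
          fix t
          \<comment> \<open>The row lies in the double window around \<open>n\<close> exactly if the
            column \<open>pos i - t\<close> lies in the one around \<open>n - t\<close>. This gives
            a bound that does not depend on the row.\<close>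
          have ind: "(indicator ?W (pos i) :: ennreal) = indicator {(n - t) - 2 * int R..(n - t) + 2 * int R} (pos i - t)"
            by (auto simp: indicator_def)
          show "(indicator ?W (pos i) + indicator ?W (pos i - t)) * u (pos i - t) \<le> V (n - t) + V n"
            unfolding ind distrib_right V_def by (intro add_mono SUP_upper) auto
        qed auto
        finally show "ennreal (norm (app ?v i) powr p) \<le> Z n" .
      qed
      finally show "indicator {n - int R..n + int R} k * u k \<le> ennreal (C powr p) * Z n" .
    qed
    have bsum: "(\<integral>\<^sup>+n. b n \<partial>count_space UNIV) = ennreal (4 * real R + 1) * Y"
    proof -
      have "(\<integral>\<^sup>+n. b n \<partial>count_space UNIV) = (\<integral>\<^sup>+i. (\<integral>\<^sup>+n. indicator {n - 2 * int R..n + 2 * int R} (pos i) * ennreal (norm (app c i) powr p) \<partial>count_space UNIV) \<partial>count_space I)"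
        unfolding b_def by (rule nn_integral_count_space_nn_integral) (auto simp: countable_rows)
      also have "\<dots> = (\<integral>\<^sup>+i. ennreal (4 * real R + 1) * ennreal (norm (app c i) powr p) \<partial>count_space I)"
      proof (rule nn_integral_cong)
        fix i
        have "(\<integral>\<^sup>+n. indicator {n - 2 * int R..n + 2 * int R} (pos i) * ennreal (norm (app c i) powr p) \<partial>count_space UNIV)
            = (\<integral>\<^sup>+n. indicator {pos i - 2 * int R..pos i + 2 * int R} n * ennreal (norm (app c i) powr p) \<partial>count_space UNIV)"
          by (intro nn_integral_cong arg_cong2[where f = "(*)"]) (auto simp: indicator_def)
        also have "\<dots> = (\<integral>\<^sup>+n. indicator {pos i - 2 * int R..pos i + 2 * int R} n \<partial>count_space UNIV) * ennreal (norm (app c i) powr p)"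
          by (rule nn_integral_multc) simp
        finally show "(\<integral>\<^sup>+n. indicator {n - 2 * int R..n + 2 * int R} (pos i) * ennreal (norm (app c i) powr p) \<partial>count_space UNIV)
            = ennreal (4 * real R + 1) * ennreal (norm (app c i) powr p)"
          by (subst (asm) nn_integral_int_window) auto
      qed
      also have "\<dots> = ennreal (4 * real R + 1) * Y"
        unfolding Y_def by (rule nn_integral_cmult) simp
      finally show ?thesis .
    qed
    have Vsum: "(\<integral>\<^sup>+n. (\<integral>\<^sup>+t. ennreal (damp \<theta> R t) * (V (n - t) + V n) \<partial>count_space UNIV) \<partial>count_space UNIV) \<le> ennreal \<epsilon> * (4 * S)"
    proof -
      have "(\<integral>\<^sup>+n. (\<integral>\<^sup>+t. ennreal (damp \<theta> R t) * (V (n - t) + V n) \<partial>count_space UNIV) \<partial>count_space UNIV)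
        = (\<integral>\<^sup>+t. (\<integral>\<^sup>+n. ennreal (damp \<theta> R t) * (V (n - t) + V n) \<partial>count_space UNIV) \<partial>count_space UNIV)"
        by (rule nn_integral_count_space_nn_integral) auto
      also have "\<dots> \<le> (\<integral>\<^sup>+t. ennreal (damp \<theta> R t) * (4 * S) \<partial>count_space UNIV)"
      proof (rule nn_integral_mono)
        fix t :: int
        have "(\<integral>\<^sup>+n. V (n - t) + V n \<partial>count_space UNIV) = (\<integral>\<^sup>+n. V (n - t) \<partial>count_space UNIV) + (\<integral>\<^sup>+n. V n \<partial>count_space UNIV)"
          by (rule nn_integral_add) auto
        also have "(\<integral>\<^sup>+n. V (n - t) \<partial>count_space UNIV) = (\<integral>\<^sup>+n. V n \<partial>count_space UNIV)"
          using nn_integral_int_shift[of V "- t"] by simp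
        also have "(\<integral>\<^sup>+n. V n \<partial>count_space UNIV) + (\<integral>\<^sup>+n. V n \<partial>count_space UNIV) \<le> 2 * S + 2 * S"
          by (intro add_mono V2)
        also have "\<dots> = 4 * S" by (simp add: distrib_right[symmetric])
        finally show "(\<integral>\<^sup>+n. ennreal (damp \<theta> R t) * (V (n - t) + V n) \<partial>count_space UNIV) \<le> ennreal (damp \<theta> R t) * (4 * S)"
          by (subst nn_integral_cmult) (auto intro!: mult_left_mono)
      qed
      also have "\<dots> = ennreal \<epsilon> * (4 * S)"
        by (subst nn_integral_multc) (auto simp: nn_integral_damp \<epsilon>_def)
      finally show ?thesis .
    qed
    define E0 where "E0 = ennreal (C powr p) * (ennreal (2 powr p) * (ennreal (4 * real R + 1) * Y))"
    have "S \<le> (\<integral>\<^sup>+n. ennreal (C powr p) * Z n \<partial>count_space UNIV)"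
      unfolding S_def by (intro nn_integral_mono Xle)
    also have "\<dots> = ennreal (C powr p) * (ennreal (2 powr p) * (\<integral>\<^sup>+n. b n \<partial>count_space UNIV)
        + ennreal C2 * (\<integral>\<^sup>+n. (\<integral>\<^sup>+t. ennreal (damp \<theta> R t) * (V (n - t) + V n) \<partial>count_space UNIV) \<partial>count_space UNIV))"
      unfolding Z_def by (simp add: nn_integral_add nn_integral_cmult)
    also have "\<dots> \<le> ennreal (C powr p) * (ennreal (2 powr p) * (ennreal (4 * real R + 1) * Y) + ennreal C2 * (ennreal \<epsilon> * (4 * S)))"
      unfolding bsum by (intro mult_left_mono add_left_mono Vsum) auto
    also have "\<dots> = E0 + ennreal (B * (\<epsilon> powr (p - 1) * \<epsilon>)) * S"
    proof -
      have Beq: "B * (\<epsilon> powr (p - 1) * \<epsilon>) = C powr p * (C2 * (1 * (\<epsilon> * 4)))"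
        unfolding B_def C2_def by simp
      have "0 \<le> C2" by (simp add: C2_def)
      then have "ennreal (B * (\<epsilon> powr (p - 1) * \<epsilon>)) = ennreal (C powr p) * (ennreal C2 * (ennreal 1 * (ennreal \<epsilon> * ennreal 4)))"
        unfolding Beq using e0 by (subst ennreal_mult_nested) auto
      then have "ennreal (B * (\<epsilon> powr (p - 1) * \<epsilon>)) * S = ennreal (C powr p) * (ennreal C2 * (ennreal \<epsilon> * (4 * S)))"
        by (simp add: mult.assoc)
      then show ?thesis by (simp only: E0_def distrib_left)
    qed
    finally have "S \<le> 2 * E0"
      by (rule ennreal_absorb_half) (use small S_fin in \<open>auto simp: \<epsilon>_def intro!: ennreal_leI simp del: ennreal_half\<close>)
    have "(\<integral>\<^sup>+k. ennreal (norm (c k) powr p) \<partial>count_space UNIV) \<le> S"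
      unfolding S_def
    proof (rule nn_integral_mono)
      fix k
      have "ennreal (norm (c k) powr p) = indicator {k - int R..k + int R} k * u k"
        by (simp add: u_def)
      also have "\<dots> \<le> X k"
        unfolding X_def by (rule SUP_upper) simp
      finally show "ennreal (norm (c k) powr p) \<le> X k" .
    qed
    also have "\<dots> \<le> 2 * E0" by fact
    also have "2 * E0 = ennreal D * Y"
    proof -
      have "ennreal D = ennreal 1 * (ennreal 2 * (ennreal (C powr p) * (ennreal (2 powr p) * ennreal (4 * real R + 1))))"
        unfolding D_def by (subst ennreal_mult_nested) auto
      then show ?thesis by (simp add: E0_def mult.assoc)
    qed
    finally show ?thesis by (simp add: Y_def)
  qed
  show ?thesis
    unfolding lower_lp_def
  proof (intro exI[of _ "1 / D"] conjI allI impI)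
    show "0 < 1 / D" using D by simp
    fix c :: "int \<Rightarrow> complex" assume s: "(\<lambda>k. norm (c k) powr p) summable_on UNIV"
    have "ennreal (1 / D) * (\<integral>\<^sup>+k. ennreal (norm (c k) powr p) \<partial>count_space UNIV)
       \<le> ennreal (1 / D) * (ennreal D * (\<integral>\<^sup>+i. ennreal (norm (app c i) powr p) \<partial>count_space I))"
      by (intro mult_left_mono main[OF s]) simp
    also have "\<dots> = (\<integral>\<^sup>+i. ennreal (norm (app c i) powr p) \<partial>count_space I)"
      using D by (simp add: mult.assoc[symmetric] ennreal_mult[symmetric])
    finally show "ennreal (1 / D) * (\<integral>\<^sup>+k. ennreal (norm (c k) powr p) \<partial>count_space UNIV)
       \<le> (\<integral>\<^sup>+i. ennreal (norm (app c i) powr p) \<partial>count_space I)" .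
  qed
qed

section \<open>Upper bounds for localized matrices\<close>

definition \<Theta> :: real where "\<Theta> = (\<Sum>\<^sub>\<infinity>t. \<theta> t)"

lemma Theta_shift: "(\<Sum>\<^sub>\<infinity>k. \<theta> (m - k)) = \<Theta>"
  unfolding \<Theta>_def by (rule infsum_reindex_bij_betw[OF bij_reflect_int])

lemma Theta_nonneg: "0 \<le> \<Theta>"
  unfolding \<Theta>_def by (rule infsum_nonneg) (rule theta_nonneg)

lemma norm_app_le:
  assumes i: "i \<in> I" and c: "\<And>k. norm (c k) \<le> K"
  shows "norm (app c i) \<le> (\<Sum>\<^sub>\<infinity>k. \<theta> (pos i - k) * norm (c k))"
proof -
  have s: "(\<lambda>k. \<theta> (pos i - k) * norm (c k)) summable_on UNIV"
    by (rule summable_on_comparison_test[OF summable_on_cmult_left[OF theta_shift_summable, of _ K]])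
       (use c theta_nonneg in \<open>auto intro!: mult_left_mono\<close>)
  show ?thesis
    unfolding app_def
    by (rule norm_infsum_le[OF has_sum_infsum[OF abs_summable_summable[OF app_summable[OF i c]]] has_sum_infsum[OF s]])
       (auto simp: norm_mult intro!: mult_right_mono entry_le[OF i])
qed

lemma app_upper_linf:
  assumes i: "i \<in> I" and c: "\<And>k. norm (c k) \<le> K"
  shows "norm (app c i) \<le> \<Theta> * K"
proof -
  have s: "(\<lambda>k. \<theta> (pos i - k) * norm (c k)) summable_on UNIV"
    by (rule summable_on_comparison_test[OF summable_on_cmult_left[OF theta_shift_summable, of _ K]])
       (use c theta_nonneg in \<open>auto intro!: mult_left_mono\<close>)
  have "norm (app c i) \<le> (\<Sum>\<^sub>\<infinity>k. \<theta> (pos i - k) * norm (c k))"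
    by (rule norm_app_le[OF assms])
  also have "\<dots> \<le> (\<Sum>\<^sub>\<infinity>k. \<theta> (pos i - k) * K)"
    by (rule infsum_mono[OF s summable_on_cmult_left[OF theta_shift_summable]])
       (use c theta_nonneg in \<open>auto intro!: mult_left_mono\<close>)
  also have "\<dots> = \<Theta> * K"
    by (subst infsum_cmult_left[OF theta_shift_summable]) (simp add: Theta_shift)
  finally show ?thesis .
qed

text \<open>Schur's test: Jensen with the weights \<open>\<theta> (pos i - k)\<close>, whose total
  mass is the same for all rows, followed by an exchange of summations. It supplies the upper half
  of the sampling inequalities.\<close>

lemma app_upper_lp:
  assumes p: "1 \<le> p" and s: "(\<lambda>k. norm (c k) powr p) summable_on UNIV"
  shows "(\<integral>\<^sup>+i. ennreal (norm (app c i) powr p) \<partial>count_space I)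
    \<le> ennreal (\<Theta> powr (p - 1) * (real Q * \<Theta>)) * (\<integral>\<^sup>+k. ennreal (norm (c k) powr p) \<partial>count_space UNIV)"
proof -
  obtain K where c: "\<And>k. norm (c k) \<le> K" using lp_bounded[OF p s] by blast
  define u where "u k = ennreal (norm (c k) powr p)" for k
  define F where "F m = (\<integral>\<^sup>+k. ennreal (\<theta> (m - k)) * u k \<partial>count_space UNIV)" for m
  have "(\<integral>\<^sup>+i. ennreal (norm (app c i) powr p) \<partial>count_space I) \<le> (\<integral>\<^sup>+i. ennreal (\<Theta> powr (p - 1)) * F (pos i) \<partial>count_space I)"
  proof (rule nn_integral_mono)
    fix i assume "i \<in> space (count_space I)"
    then have i: "i \<in> I" by simp
    have sp: "(\<lambda>k. \<theta> (pos i - k) * norm (c k) powr p) summable_on UNIV"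
      by (rule summable_on_comparison_test[OF summable_on_cmult_left[OF theta_shift_summable, of _ "K powr p"]])
         (use c theta_nonneg p in \<open>auto intro!: mult_left_mono powr_mono2\<close>)
    have "norm (app c i) powr p \<le> (\<Sum>\<^sub>\<infinity>k. \<theta> (pos i - k) * norm (c k)) powr p"
      using p by (intro powr_mono2 norm_app_le[OF i c]) auto
    also have "\<dots> \<le> (\<Sum>\<^sub>\<infinity>k. \<theta> (pos i - k)) powr (p - 1) * (\<Sum>\<^sub>\<infinity>k. \<theta> (pos i - k) * norm (c k) powr p)"
      by (rule infsum_Jensen_powr[OF theta_shift_summable theta_nonneg norm_ge_zero c p])
    finally have "ennreal (norm (app c i) powr p) \<le> ennreal (\<Theta> powr (p - 1) * (\<Sum>\<^sub>\<infinity>k. \<theta> (pos i - k) * norm (c k) powr p))"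
      unfolding Theta_shift by (rule ennreal_leI)
    also have "\<dots> = ennreal (\<Theta> powr (p - 1)) * ennreal (\<Sum>\<^sub>\<infinity>k. \<theta> (pos i - k) * norm (c k) powr p)"
      by (rule ennreal_mult) (auto intro!: infsum_nonneg mult_nonneg_nonneg theta_nonneg)
    also have "ennreal (\<Sum>\<^sub>\<infinity>k. \<theta> (pos i - k) * norm (c k) powr p) = F (pos i)"
      unfolding F_def u_def by (subst ennreal_infsum_eq_nn_integral[OF _ sp]) (auto simp: ennreal_mult theta_nonneg)
    finally show "ennreal (norm (app c i) powr p) \<le> ennreal (\<Theta> powr (p - 1)) * F (pos i)" .
  qed
  also have "\<dots> = ennreal (\<Theta> powr (p - 1)) * (\<integral>\<^sup>+i. F (pos i) \<partial>count_space I)"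
    by (rule nn_integral_cmult) simp
  also have "\<dots> \<le> ennreal (\<Theta> powr (p - 1)) * (of_nat Q * (\<integral>\<^sup>+m. F m \<partial>count_space UNIV))"
    by (intro mult_left_mono nn_integral_rows_le) simp
  also have "(\<integral>\<^sup>+m. F m \<partial>count_space UNIV) = (\<integral>\<^sup>+k. (\<integral>\<^sup>+m. ennreal (\<theta> (m - k)) * u k \<partial>count_space UNIV) \<partial>count_space UNIV)"
    unfolding F_def by (rule nn_integral_count_space_nn_integral) auto
  also have "\<dots> = (\<integral>\<^sup>+k. ennreal \<Theta> * u k \<partial>count_space UNIV)"
  proof (rule nn_integral_cong)
    fix k
    have "(\<integral>\<^sup>+m. ennreal (\<theta> (m - k)) \<partial>count_space UNIV) = (\<integral>\<^sup>+m. ennreal (\<theta> m) \<partial>count_space UNIV)"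
      using nn_integral_int_shift[of "\<lambda>m. ennreal (\<theta> m)" "- k"] by simp
    also have "\<dots> = ennreal \<Theta>"
      unfolding \<Theta>_def by (rule ennreal_infsum_eq_nn_integral[OF _ theta_summable theta_nonneg, symmetric]) simp
    finally show "(\<integral>\<^sup>+m. ennreal (\<theta> (m - k)) * u k \<partial>count_space UNIV) = ennreal \<Theta> * u k"
      by (subst nn_integral_multc) auto
  qed
  also have "\<dots> = ennreal \<Theta> * (\<integral>\<^sup>+k. u k \<partial>count_space UNIV)"
    by (rule nn_integral_cmult) simp
  finally show ?thesis
    using Theta_nonneg by (simp add: u_def ennreal_mult ennreal_of_nat_eq_real_of_nat mult.assoc)
qed

end

section \<open>Shift-invariant spaces\<close>

definition cell_sup :: "(real \<Rightarrow> complex) \<Rightarrow> int \<Rightarrow> real" where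
  "cell_sup h k = Sup ((\<lambda>x. norm (h x)) ` {real_of_int k .. real_of_int k + 1})"

lemma cell_sup_ge:
  assumes "W0 h" "real_of_int k \<le> x" "x \<le> real_of_int k + 1"
  shows "norm (h x) \<le> cell_sup h k"
  unfolding cell_sup_def
proof (rule cSUP_upper)
  have "continuous_on {real_of_int k .. real_of_int k + 1} (\<lambda>x. norm (h x))"
    using assms(1) unfolding W0_def by (intro continuous_on_norm) (auto intro: continuous_on_subset)
  then show "bdd_above ((\<lambda>x. norm (h x)) ` {real_of_int k .. real_of_int k + 1})"
    by (intro bounded_imp_bdd_above compact_imp_bounded compact_continuous_image) auto
qed (use assms in auto)

lemma cell_sup_nonneg: "W0 h \<Longrightarrow> 0 \<le> cell_sup h k"
  by (rule order_trans[OF norm_ge_zero cell_sup_ge[of h k "real_of_int k"]]) auto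

lemma cell_sup_summable: "W0 h \<Longrightarrow> cell_sup h summable_on UNIV"
  by (simp add: W0_def cell_sup_def[abs_def])

lemma cell_sup_shift_summable: "W0 h \<Longrightarrow> (\<lambda>k. cell_sup h (m - k)) summable_on UNIV"
  by (rule summable_on_reindex_bij_betw[THEN iffD2, OF _ cell_sup_summable])
     (auto intro!: bij_betw_byWitness[where f' = "\<lambda>k. m - k"])

lemma norm_shift_le_cell_sup:
  assumes "W0 h"
  shows "norm (h (x - real_of_int k)) \<le> cell_sup h (\<lfloor>x\<rfloor> - k)"
proof (rule cell_sup_ge[OF assms])
  show "real_of_int (\<lfloor>x\<rfloor> - k) \<le> x - real_of_int k" by simp
  show "x - real_of_int k \<le> real_of_int (\<lfloor>x\<rfloor> - k) + 1" by linarith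
qed

text \<open>A majorant serving all points at distance less than 1 from \<open>x\<close> at once:
  such a move changes the floor by at most 1, hence the three neighbouring cells.\<close>

definition near_sup :: "(real \<Rightarrow> complex) \<Rightarrow> real \<Rightarrow> int \<Rightarrow> real" where
  "near_sup h x k = cell_sup h (\<lfloor>x\<rfloor> - 1 - k) + (cell_sup h (\<lfloor>x\<rfloor> - k) + cell_sup h (\<lfloor>x\<rfloor> + 1 - k))"

lemma near_sup_summable: "W0 h \<Longrightarrow> near_sup h x summable_on UNIV"
  unfolding near_sup_def[abs_def] by (intro summable_on_add cell_sup_shift_summable)

lemma norm_shift_le_near_sup:
  assumes "W0 h" "\<bar>y - x\<bar> < 1"
  shows "norm (h (y - real_of_int k)) \<le> near_sup h x k"
proof -
  have "\<lfloor>y\<rfloor> = \<lfloor>x\<rfloor> - 1 \<or> \<lfloor>y\<rfloor> = \<lfloor>x\<rfloor> \<or> \<lfloor>y\<rfloor> = \<lfloor>x\<rfloor> + 1"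
    using assms(2) by linarith
  then show ?thesis
    using norm_shift_le_cell_sup[OF assms(1), of y k] cell_sup_nonneg[OF assms(1)]
    unfolding near_sup_def by (smt (verit))
qed

text \<open>Coefficients and evaluation point vary together, the coefficients converging entrywise
  under a uniform bound. This covers both the continuity of a fixed combination and the passage to a
  weak limit.\<close>

lemma shiftsum_tendsto:
  assumes h: "W0 h" and G: "G \<noteq> bot"
    and c: "\<And>k. ((\<lambda>n. cn n k) \<longlongrightarrow> c k) G" "\<And>n k. norm (cn n k) \<le> K"
    and x: "(xn \<longlongrightarrow> x) G"
  shows "((\<lambda>n. shiftsum h (cn n) (xn n)) \<longlongrightarrow> shiftsum h c x) G"
  unfolding shiftsum_def
proof (rule infsum_tannery[OF G])
  have cont: "isCont h y" for y
    using h by (simp add: W0_def continuous_on_eq_continuous_at)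
  show "((\<lambda>n. cn n k * h (xn n - real_of_int k)) \<longlongrightarrow> c k * h (x - real_of_int k)) G" for k
    by (intro tendsto_mult c isCont_tendsto_compose[OF cont] tendsto_diff x tendsto_const)
  show "(\<lambda>k. K * near_sup h x k) summable_on UNIV"
    by (intro summable_on_cmult_right near_sup_summable h)
  have "\<forall>\<^sub>F n in G. \<bar>xn n - x\<bar> < 1"
    using tendstoD[OF x, of 1] by (simp add: dist_real_def)
  then show "\<forall>\<^sub>F n in G. \<forall>k. norm (cn n k * h (xn n - real_of_int k)) \<le> K * near_sup h x k"
  proof (rule eventually_mono, intro allI)
    fix n k assume "\<bar>xn n - x\<bar> < 1"
    moreover have "0 \<le> K" using c(2)[of n 0] norm_ge_zero order_trans by blast
    ultimately show "norm (cn n k * h (xn n - real_of_int k)) \<le> K * near_sup h x k"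
      using c(2)[of n k] norm_shift_le_near_sup[OF h] by (auto simp: norm_mult intro!: mult_mono)
  qed
qed

text \<open>Differentiation under the limit is applied to sequences, so the unordered sums are
  evaluated along symmetric intervals, which are cofinal among the finite sets.\<close>

lemma filterlim_int_intervals: "filterlim (\<lambda>n. {- int n..int n}) (finite_subsets_at_top UNIV) sequentially"
  unfolding filterlim_finite_subsets_at_top
proof (intro allI impI)
  fix X :: "int set" assume X: "finite X \<and> X \<subseteq> UNIV"
  define n0 where "n0 = nat (Max (insert 0 (abs ` X)))"
  have n0: "\<bar>k\<bar> \<le> int n0" if "k \<in> X" for k
  proof -
    have "\<bar>k\<bar> \<le> Max (insert 0 (abs ` X))" using X that by (intro Max_ge) auto
    then show ?thesis unfolding n0_def by linarith
  qed
  show "\<forall>\<^sub>F n in sequentially. finite {- int n..int n} \<and> X \<subseteq> {- int n..int n} \<and> {- int n..int n} \<subseteq> UNIV"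
    using eventually_ge_at_top[of n0]
  proof (rule eventually_mono)
    fix n assume "n0 \<le> n"
    then have "\<bar>k\<bar> \<le> int n" if "k \<in> X" for k using n0[OF that] by linarith
    then show "finite {- int n..int n} \<and> X \<subseteq> {- int n..int n} \<and> {- int n..int n} \<subseteq> UNIV"
      by (auto simp: abs_le_iff) (smt (verit) abs_le_iff)
  qed
qed

lemma shiftsum_uniform_limit:
  assumes h: "W0 h" and c: "\<And>k. norm (c k) \<le> K"
  shows "uniform_limit {x - 1<..<x + 1} (\<lambda>n y. \<Sum>k\<in>{- int n..int n}. c k * h (y - real_of_int k)) (shiftsum h c) sequentially"
proof -
  have "uniform_limit {x - 1<..<x + 1} (\<lambda>X y. \<Sum>k\<in>X. c k * h (y - real_of_int k)) (shiftsum h c) (finite_subsets_at_top UNIV)"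
    unfolding shiftsum_def
  proof (rule Weierstrass_m_test_general)
    show "(\<lambda>k. K * near_sup h x k) summable_on UNIV"
      by (intro summable_on_cmult_right near_sup_summable h)
    fix k y assume "y \<in> {x - 1<..<x + 1}"
    then have "\<bar>y - x\<bar> < 1" by auto
    moreover have "0 \<le> K" using c[of 0] norm_ge_zero order_trans by blast
    ultimately show "norm (c k * h (y - real_of_int k)) \<le> K * near_sup h x k"
      using c[of k] norm_shift_le_near_sup[OF h] by (auto simp: norm_mult intro!: mult_mono)
  qed
  then show ?thesis
    by (rule filterlim_compose[OF _ filterlim_int_intervals])
qed

text \<open>Term-by-term differentiation. Differentiability being local, uniform convergence of the
  differentiated sums on the unit neighbourhood of \<open>x\<close> suffices, and there
  \<open>near_sup\<close> is a common majorant.\<close>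

lemma shiftsum_has_vector_derivative:
  assumes h: "W0 h" "W0 h'" and d: "\<And>x. (h has_vector_derivative h' x) (at x)" and c: "\<And>k. norm (c k) \<le> K"
  shows "(shiftsum h c has_vector_derivative shiftsum h' c x) (at x)"
proof -
  define S where "S = {x - 1<..<x + 1}"
  define f where "f n y = (\<Sum>k\<in>{- int n..int n}. c k * h (y - real_of_int k))" for n y
  define f' where "f' n y = (\<Sum>k\<in>{- int n..int n}. c k * h' (y - real_of_int k))" for n y
  have xS: "x \<in> S" by (simp add: S_def)
  have lim: "(\<lambda>n. f n y) \<longlonglongrightarrow> shiftsum h c y" if "y \<in> S" for y
    unfolding f_def using that S_def
    by (intro tendsto_uniform_limitI[OF shiftsum_uniform_limit[where x = x, OF h(1) c]]) auto
  have "\<exists>G. \<forall>y\<in>S. (\<lambda>n. f n y) \<longlonglongrightarrow> G y \<and> (G has_derivative (\<lambda>t. t *\<^sub>R shiftsum h' c y)) (at y within S)"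
  proof (rule has_derivative_sequence[where f' = "\<lambda>n y t. t *\<^sub>R f' n y"])
    show "convex S" by (simp add: S_def)
    show "x \<in> S" by (rule xS)
    show "(\<lambda>n. f n x) \<longlonglongrightarrow> shiftsum h c x" by (rule lim[OF xS])
    fix n y
    have "((\<lambda>y. h (y - real_of_int k)) has_vector_derivative h' (y - real_of_int k)) (at y within S)" for k
    proof -
      have "((\<lambda>y. y - real_of_int k) has_vector_derivative 1) (at y within S)"
        by (auto intro!: derivative_eq_intros)
      from vector_diff_chain_within[OF this has_vector_derivative_at_within[OF d]] show ?thesis
        by (simp add: o_def)
    qed
    then have "(f n has_vector_derivative f' n y) (at y within S)"
      unfolding f_def f'_def by (intro has_vector_derivative_sum has_vector_derivative_mult_right)
    then show "(f n has_derivative (\<lambda>t. t *\<^sub>R f' n y)) (at y within S)"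
      by (simp add: has_vector_derivative_def)
  next
    fix e :: real assume "e > 0"
    have "uniform_limit S f' (shiftsum h' c) sequentially"
      unfolding f'_def S_def by (rule shiftsum_uniform_limit[OF h(2) c])
    then have "\<forall>\<^sub>F n in sequentially. \<forall>y\<in>S. dist (f' n y) (shiftsum h' c y) < e"
      using \<open>e > 0\<close> by (rule uniform_limitD)
    then show "\<forall>\<^sub>F n in sequentially. \<forall>y\<in>S. \<forall>t. norm (t *\<^sub>R f' n y - t *\<^sub>R shiftsum h' c y) \<le> e * norm t"
    proof (rule eventually_mono, intro ballI allI)
      fix n y t assume "\<forall>y\<in>S. dist (f' n y) (shiftsum h' c y) < e" "y \<in> S"
      then have "norm (f' n y - shiftsum h' c y) \<le> e" by (auto simp: dist_norm intro: less_imp_le)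
      then show "norm (t *\<^sub>R f' n y - t *\<^sub>R shiftsum h' c y) \<le> e * norm t"
        using mult_left_mono[of _ e "\<bar>t\<bar>"] by (simp add: scaleR_diff_right[symmetric] mult.commute[of e])
    qed
  qed
  then obtain G where G: "\<And>y. y \<in> S \<Longrightarrow> (\<lambda>n. f n y) \<longlonglongrightarrow> G y"
      "\<And>y. y \<in> S \<Longrightarrow> (G has_derivative (\<lambda>t. t *\<^sub>R shiftsum h' c y)) (at y within S)"
    by blast
  have "(shiftsum h c has_derivative (\<lambda>t. t *\<^sub>R shiftsum h' c x)) (at x within S)"
    by (rule has_derivative_transform[OF xS _ G(2)[OF xS]]) (use LIMSEQ_unique[OF lim G(1)] in auto)
  moreover have "open S" by (simp add: S_def)
  ultimately have "(shiftsum h c has_derivative (\<lambda>t. t *\<^sub>R shiftsum h' c x)) (at x)"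
    by (simp add: at_within_open[OF xS])
  then show ?thesis by (simp add: has_vector_derivative_def)
qed

lemma nderiv_shiftsum:
  assumes "W0N N g" "j < N" "\<And>k. norm (c k) \<le> K"
  shows "nderiv j (shiftsum g c) = shiftsum (nderiv j g) c"
  using assms(2)
proof (induction j)
  case (Suc j)
  then have IH: "nderiv j (shiftsum g c) = shiftsum (nderiv j g) c" by simp
  have W: "W0 (nderiv j g)" "W0 (nderiv (Suc j) g)"
    using assms(1) Suc.prems unfolding W0N_def by (metis Suc_lessD, blast)
  have "(nderiv j g has_vector_derivative nderiv (Suc j) g x) (at x)" for x
    using assms(1) Suc.prems unfolding W0N_def by (simp add: vector_derivative_works[symmetric])
  from shiftsum_has_vector_derivative[OF W this assms(3)] show ?case
    by (auto simp: IH fun_eq_iff intro!: vector_derivative_at)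
qed simp

section \<open>Sampling as a lower bound for a matrix\<close>

definition sample_index :: "real set \<Rightarrow> (real \<Rightarrow> nat) \<Rightarrow> (real \<times> nat) set" where
  "sample_index L m = {(l, j). l \<in> L \<and> j < m l}"

definition row_pos :: "real \<times> nat \<Rightarrow> int" where
  "row_pos i = \<lfloor>fst i\<rfloor>"

definition entry :: "(real \<Rightarrow> complex) \<Rightarrow> real \<times> nat \<Rightarrow> int \<Rightarrow> complex" where
  "entry g i k = nderiv (snd i) g (fst i - real_of_int k)"

text \<open>Summing over the derivative orders gives one majorant for all rows, whichever derivative
  they sample.\<close>

definition envelope :: "nat \<Rightarrow> (real \<Rightarrow> complex) \<Rightarrow> int \<Rightarrow> real" where
  "envelope N g t = (\<Sum>j<N. cell_sup (nderiv j g) t)"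

lemma floor_div_inj_on:
  fixes \<delta> :: real
  assumes "0 < \<delta>" "\<forall>x\<in>L. \<forall>y\<in>L. x \<noteq> y \<longrightarrow> \<delta> \<le> \<bar>x - y\<bar>"
  shows "inj_on (\<lambda>l. \<lfloor>l / \<delta>\<rfloor>) L"
proof (rule inj_onI, rule ccontr)
  fix x y assume xy: "x \<in> L" "y \<in> L" "\<lfloor>x / \<delta>\<rfloor> = \<lfloor>y / \<delta>\<rfloor>" "x \<noteq> y"
  have "\<bar>x / \<delta> - y / \<delta>\<bar> < 1" using xy(3) by linarith
  then have "\<bar>x - y\<bar> < \<delta>" using assms(1) by (simp add: diff_divide_distrib[symmetric] pos_divide_less_eq)
  then show False using assms(2) xy by fastforce
qed

lemma separated_countable:
  assumes "separated L"
  shows "countable L"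
proof -
  obtain \<delta> where "0 < \<delta>" "\<forall>x\<in>L. \<forall>y\<in>L. x \<noteq> y \<longrightarrow> \<delta> \<le> \<bar>x - y\<bar>"
    using assms by (auto simp: separated_def)
  from floor_div_inj_on[OF this] show ?thesis
    by (rule countable_image_inj_on[rotated]) simp
qed

text \<open>Rounding \<open>l / \<delta>\<close> down is injective on the set and sends the points
  of a unit cell into an integer interval with at most
  \<open>\<lceil>1 / \<delta>\<rceil> + 2\<close> elements.\<close>

lemma separated_fibre:
  assumes "separated L"
  obtains q where "\<And>n. finite {l \<in> L. \<lfloor>l\<rfloor> = n}" "\<And>n. card {l \<in> L. \<lfloor>l\<rfloor> = n} \<le> q"
proof -
  obtain \<delta> where \<delta>: "0 < \<delta>" "\<forall>x\<in>L. \<forall>y\<in>L. x \<noteq> y \<longrightarrow> \<delta> \<le> \<bar>x - y\<bar>"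
    using assms by (auto simp: separated_def)
  define q where "q = nat (\<lceil>1 / \<delta>\<rceil> + 2)"
  have *: "finite {l \<in> L. \<lfloor>l\<rfloor> = n} \<and> card {l \<in> L. \<lfloor>l\<rfloor> = n} \<le> q" for n
  proof -
    let ?F = "\<lambda>l. \<lfloor>l / \<delta>\<rfloor>" and ?A = "{l \<in> L. \<lfloor>l\<rfloor> = n}"
    let ?B = "{\<lfloor>real_of_int n / \<delta>\<rfloor>..\<lfloor>(real_of_int n + 1) / \<delta>\<rfloor>}"
    have inj: "inj_on ?F ?A"
      by (rule inj_on_subset[OF floor_div_inj_on[OF \<delta>]]) auto
    have sub: "?F ` ?A \<subseteq> ?B"
    proof
      fix z assume "z \<in> ?F ` ?A"
      then obtain l where l: "z = \<lfloor>l / \<delta>\<rfloor>" "\<lfloor>l\<rfloor> = n" by auto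
      then have "real_of_int n \<le> l" "l \<le> real_of_int n + 1" by linarith+
      then show "z \<in> ?B"
        using l \<delta>(1) by (auto intro!: floor_mono divide_right_mono)
    qed
    have "\<lfloor>(real_of_int n + 1) / \<delta>\<rfloor> - \<lfloor>real_of_int n / \<delta>\<rfloor> + 1 \<le> \<lceil>1 / \<delta>\<rceil> + 2"
      unfolding add_divide_distrib by linarith
    then have "card ?B \<le> q" by (simp add: q_def)
    moreover have "card ?A \<le> card ?B"
      by (rule card_inj_on_le[OF inj sub]) simp
    ultimately show ?thesis
      using inj_on_finite[OF inj sub] by auto
  qed
  show thesis by (rule that) (use * in auto)
qed

lemma localized_rows:
  assumes g: "W0N N g" and L: "separated L" and m: "\<And>l. l \<in> L \<Longrightarrow> m l \<le> N"
  shows "\<exists>Q. localized_matrix (sample_index L m) row_pos (entry g) (envelope N g) Q"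
proof -
  obtain q where q: "\<And>n. finite {l \<in> L. \<lfloor>l\<rfloor> = n}" "\<And>n. card {l \<in> L. \<lfloor>l\<rfloor> = n} \<le> q"
    using separated_fibre[OF L] by blast
  have W: "W0 (nderiv j g)" if "j < N" for j
    using g that by (simp add: W0N_def)
  have sub: "{i \<in> sample_index L m. row_pos i = n} \<subseteq> {l \<in> L. \<lfloor>l\<rfloor> = n} \<times> {..<N}" for n
    using m by (auto simp: sample_index_def row_pos_def intro: less_le_trans)
  show ?thesis
  proof (intro exI[of _ "q * N"], unfold_locales)
    show "0 \<le> envelope N g t" for t
      unfolding envelope_def by (intro sum_nonneg cell_sup_nonneg W) auto
    show "envelope N g summable_on UNIV"
    proof -
      have "(\<lambda>t. \<Sum>j\<in>F. cell_sup (nderiv j g) t) summable_on UNIV" if "finite F" "F \<subseteq> {..<N}" for F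
        using that by (induction F) (auto intro!: summable_on_add cell_sup_summable W)
      then show ?thesis unfolding envelope_def[abs_def] by simp
    qed
    show "finite {i \<in> sample_index L m. row_pos i = n}" for n
      by (rule finite_subset[OF sub]) (use q in auto)
    show "card {i \<in> sample_index L m. row_pos i = n} \<le> q * N" for n
    proof -
      have "card {i \<in> sample_index L m. row_pos i = n} \<le> card ({l \<in> L. \<lfloor>l\<rfloor> = n} \<times> {..<N})"
        by (rule card_mono[OF _ sub]) (use q in auto)
      also have "\<dots> \<le> q * N" using q(2)[of n] by (simp add: card_cartesian_product)
      finally show ?thesis .
    qed
    fix i k assume "i \<in> sample_index L m"
    then have j: "snd i < N" using m by (auto simp: sample_index_def intro: less_le_trans)
    have "norm (entry g i k) \<le> cell_sup (nderiv (snd i) g) (row_pos i - k)"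
      unfolding entry_def row_pos_def by (rule norm_shift_le_cell_sup[OF W[OF j]])
    also have "\<dots> \<le> envelope N g (row_pos i - k)"
      unfolding envelope_def
      by (rule member_le_sum[of "snd i" "{..<N}" "\<lambda>j. cell_sup (nderiv j g) (row_pos i - k)"])
         (use j cell_sup_nonneg[OF W] in auto)
    finally show "norm (entry g i k) \<le> envelope N g (row_pos i - k)" .
  qed
qed

lemma nn_integral_rows:
  fixes F :: "real \<Rightarrow> nat \<Rightarrow> ennreal"
  assumes "countable L"
  shows "(\<Sum>\<^sub>\<infinity>l\<in>L. \<Sum>j<m l. F l j) = (\<integral>\<^sup>+i. F (fst i) (snd i) \<partial>count_space (sample_index L m))"
proof -
  have "(\<integral>\<^sup>+i. F (fst i) (snd i) \<partial>count_space (sample_index L m))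
      = (\<integral>\<^sup>+i. F (fst i) (snd i) * indicator (sample_index L m) i \<partial>count_space UNIV)"
    by (rule nn_integral_count_space_indicator) simp
  also have "\<dots> = (\<integral>\<^sup>+l. \<integral>\<^sup>+j. F l j * indicator (sample_index L m) (l, j) \<partial>count_space UNIV \<partial>count_space UNIV)"
    by (subst nn_integral_fst_count_space[symmetric]) simp
  also have "\<dots> = (\<integral>\<^sup>+l. (\<Sum>j<m l. F l j) * indicator L l \<partial>count_space UNIV)"
  proof (rule nn_integral_cong)
    fix l
    show "(\<integral>\<^sup>+j. F l j * indicator (sample_index L m) (l, j) \<partial>count_space UNIV) = (\<Sum>j<m l. F l j) * indicator L l"
      by (subst nn_integral_count_space'[of "{..<m l}"]) (auto simp: sample_index_def indicator_def)
  qed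
  also have "\<dots> = (\<integral>\<^sup>+l. (\<Sum>j<m l. F l j) \<partial>count_space L)"
    by (rule nn_integral_count_space_indicator[symmetric]) simp
  finally show ?thesis
    by (simp add: infsum_ennreal_eq_nn_integral[OF assms])
qed

locale sampling_rows =
  fixes g :: "real \<Rightarrow> complex" and N :: nat and L :: "real set" and m :: "real \<Rightarrow> nat"
  assumes W: "W0N N g" and stable: "stable_shifts g" and L: "separated L" and m: "\<And>l. l \<in> L \<Longrightarrow> m l \<le> N"
begin

text \<open>Instantiating the matrix locale requires a term, whereas \<open>localized_rows\<close>
  only asserts that a bound exists; any admissible choice will do.\<close>

definition Q :: nat where
  "Q = (SOME Q. localized_matrix (sample_index L m) row_pos (entry g) (envelope N g) Q)"

sublocale localized_matrix "sample_index L m" row_pos "entry g" "envelope N g" Q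
  unfolding Q_def by (rule someI_ex[OF localized_rows[OF W L m]])

lemma nderiv_eq_app:
  assumes "i \<in> sample_index L m" "\<And>k. norm (c k) \<le> K"
  shows "nderiv (snd i) (shiftsum g c) (fst i) = app c i"
proof -
  have j: "snd i < N" using assms(1) m by (auto simp: sample_index_def intro: less_le_trans)
  show ?thesis
    by (simp only: nderiv_shiftsum[OF W j assms(2)]) (simp only: app_def shiftsum_def entry_def mult.commute)
qed

text \<open>Stability of the shifts turns the norm of the function into the norm of its
  coefficients. The upper sampling inequality follows from \<open>app_upper_lp\<close>, so only the
  lower one has content.\<close>

lemma sampling_lp_iff:
  assumes p: "1 \<le> p"
  shows "sampling_set g (ereal p) L m \<longleftrightarrow> lower_lp p (\<lambda>c. (\<lambda>k. norm (c k) powr p) summable_on UNIV)"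
proof -
  define P where "P c \<longleftrightarrow> (\<lambda>k. norm (c k) powr p) summable_on UNIV" for c :: "int \<Rightarrow> complex"
  define Y where "Y c = (\<integral>\<^sup>+i. ennreal (norm (app c i) powr p) \<partial>count_space (sample_index L m))" for c
  define U where "U c = (\<integral>\<^sup>+k. ennreal (norm (c k) powr p) \<partial>count_space UNIV)" for c :: "int \<Rightarrow> complex"
  have bdd: "\<exists>K. \<forall>k. norm (c k) \<le> K" if "P c" for c
    using lp_bounded[OF p] that by (auto simp: P_def)
  have Y: "(\<Sum>\<^sub>\<infinity>l\<in>L. \<Sum>j<m l. ennreal (norm (nderiv j (shiftsum g c) l) powr p)) = Y c" if c: "P c" for c
  proof -
    obtain K where K: "\<And>k. norm (c k) \<le> K" using bdd[OF c] by blast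
    show ?thesis
      unfolding nn_integral_rows[OF separated_countable[OF L]] Y_def
      by (intro nn_integral_cong) (simp add: nderiv_eq_app[OF _ K])
  qed
  have U: "lp_sum p c = U c" for c
    unfolding lp_sum_def U_def by (rule infsum_ennreal_eq_nn_integral) simp
  have Vp: "Vp g (ereal p) = shiftsum g ` Collect P"
    by (auto simp: Vp_def lp_space_def P_def)
  obtain A B where AB: "0 < A" "0 < B" and
    stab: "\<And>c. P c \<Longrightarrow> ennreal A * U c \<le> Lp_int p (shiftsum g c)" "\<And>c. P c \<Longrightarrow> Lp_int p (shiftsum g c) \<le> ennreal B * U c"
  proof -
    have "\<exists>A B. 0 < A \<and> 0 < B \<and> (\<forall>c. lp_space (ereal p) c \<longrightarrow>
        ennreal A * lp_sum p c \<le> Lp_int p (shiftsum g c) \<and> Lp_int p (shiftsum g c) \<le> ennreal B * lp_sum p c)"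
      using stable p unfolding stable_shifts_def by blast
    then show thesis
      using that unfolding U by (auto simp: lp_space_def P_def)
  qed
  have samp: "sampling_set g (ereal p) L m \<longleftrightarrow> (\<exists>A' B'. 0 < A' \<and> 0 < B' \<and> (\<forall>c. P c \<longrightarrow>
      ennreal A' * Lp_int p (shiftsum g c) \<le> Y c \<and> Y c \<le> ennreal B' * Lp_int p (shiftsum g c)))"
    unfolding sampling_set_def Vp by (simp add: Y del: sum_ennreal)
  have low: "lower_lp p P \<longleftrightarrow> (\<exists>A'>0. \<forall>c. P c \<longrightarrow> ennreal A' * U c \<le> Y c)"
    unfolding lower_lp_def U_def Y_def ..
  have "sampling_set g (ereal p) L m \<longleftrightarrow> lower_lp p P"
  proof
    assume "sampling_set g (ereal p) L m"
    then obtain A' where A': "0 < A'" "\<And>c. P c \<Longrightarrow> ennreal A' * Lp_int p (shiftsum g c) \<le> Y c"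
      unfolding samp by blast
    have "ennreal (A' * A) * U c \<le> Y c" if "P c" for c
    proof -
      have "ennreal (A' * A) * U c = ennreal A' * (ennreal A * U c)"
        using A'(1) AB by (simp add: ennreal_mult mult.assoc)
      also have "\<dots> \<le> ennreal A' * Lp_int p (shiftsum g c)"
        by (intro mult_left_mono stab that) simp
      also have "\<dots> \<le> Y c" by (rule A'(2)[OF that])
      finally show ?thesis .
    qed
    then show "lower_lp p P" unfolding low using A'(1) AB by (intro exI[of _ "A' * A"]) auto
  next
    assume "lower_lp p P"
    then obtain A' where A': "0 < A'" "\<And>c. P c \<Longrightarrow> ennreal A' * U c \<le> Y c"
      unfolding low by blast
    \<comment> \<open>The summand 1 gives a positive constant without excluding that
      \<open>\<Theta>\<close> or \<open>Q\<close> vanishes.\<close>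
    define D where "D = \<Theta> powr (p - 1) * (real Q * \<Theta>) + 1"
    have D: "0 < D" unfolding D_def using Theta_nonneg by (intro add_nonneg_pos) auto
    have "ennreal (A' / B) * Lp_int p (shiftsum g c) \<le> Y c \<and> Y c \<le> ennreal (D / A) * Lp_int p (shiftsum g c)"
      if "P c" for c
    proof
      have "ennreal (A' / B) * Lp_int p (shiftsum g c) \<le> ennreal (A' / B) * (ennreal B * U c)"
        by (intro mult_left_mono stab that) simp
      also have "\<dots> = ennreal A' * U c"
        using A'(1) AB by (simp add: mult.assoc[symmetric] ennreal_mult[symmetric])
      also have "\<dots> \<le> Y c" by (rule A'(2)[OF that])
      finally show "ennreal (A' / B) * Lp_int p (shiftsum g c) \<le> Y c" .
      have "Y c \<le> ennreal (\<Theta> powr (p - 1) * (real Q * \<Theta>)) * U c"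
        unfolding Y_def U_def by (rule app_upper_lp[OF p]) (use that P_def in simp)
      also have "\<dots> \<le> ennreal D * U c"
        unfolding D_def by (intro mult_right_mono ennreal_leI) auto
      also have "\<dots> = ennreal (D / A) * (ennreal A * U c)"
        using D AB by (simp add: mult.assoc[symmetric] ennreal_mult[symmetric])
      also have "\<dots> \<le> ennreal (D / A) * Lp_int p (shiftsum g c)"
        by (intro mult_left_mono stab that) simp
      finally show "Y c \<le> ennreal (D / A) * Lp_int p (shiftsum g c)" .
    qed
    then show "sampling_set g (ereal p) L m"
      unfolding samp using A'(1) AB D by (intro exI[of _ "A' / B"] exI[of _ "D / A"]) auto
  qed
  then show ?thesis unfolding P_def .
qed

lemma sampling_linf_iff: "sampling_set g \<infinity> L m \<longleftrightarrow> lower_linf (\<lambda>c. bounded (range c))"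
proof -
  define P where "P c \<longleftrightarrow> bounded (range c)" for c :: "int \<Rightarrow> complex"
  define Y where "Y c = (SUP i\<in>sample_index L m. ennreal (norm (app c i)))" for c
  have bdd: "\<exists>K. \<forall>k. norm (c k) \<le> K" if "P c" for c
    using that by (auto simp: P_def bounded_iff)
  have Y: "(SUP (l, j)\<in>{(l, j). l \<in> L \<and> j < m l}. ennreal (norm (nderiv j (shiftsum g c) l))) = Y c" if c: "P c" for c
  proof -
    obtain K where K: "\<And>k. norm (c k) \<le> K" using bdd[OF c] by blast
    show ?thesis
      unfolding Y_def sample_index_def[symmetric] using nderiv_eq_app[OF _ K]
      by (intro SUP_cong) (auto simp: case_prod_beta)
  qed
  have Vp: "Vp g \<infinity> = shiftsum g ` Collect P"
    by (auto simp: Vp_def lp_space_def P_def)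
  obtain A B where AB: "0 < A" "0 < B" and
    stab: "\<And>c. P c \<Longrightarrow> ennreal A * sup_seq c \<le> sup_fun (shiftsum g c)" "\<And>c. P c \<Longrightarrow> sup_fun (shiftsum g c) \<le> ennreal B * sup_seq c"
  proof -
    have "\<exists>A B. 0 < A \<and> 0 < B \<and> (\<forall>c. lp_space \<infinity> c \<longrightarrow>
        ennreal A * sup_seq c \<le> sup_fun (shiftsum g c) \<and> sup_fun (shiftsum g c) \<le> ennreal B * sup_seq c)"
      using stable unfolding stable_shifts_def by blast
    then show thesis
      using that by (auto simp: lp_space_def P_def)
  qed
  have samp: "sampling_set g \<infinity> L m \<longleftrightarrow> (\<exists>A' B'. 0 < A' \<and> 0 < B' \<and> (\<forall>c. P c \<longrightarrow>
      ennreal A' * sup_fun (shiftsum g c) \<le> Y c \<and> Y c \<le> ennreal B' * sup_fun (shiftsum g c)))"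
    unfolding sampling_set_def Vp by (simp add: Y)
  have "sampling_set g \<infinity> L m \<longleftrightarrow> lower_linf P"
  proof
    assume "sampling_set g \<infinity> L m"
    then obtain A' where A': "0 < A'" "\<And>c. P c \<Longrightarrow> ennreal A' * sup_fun (shiftsum g c) \<le> Y c"
      unfolding samp by blast
    have "norm (c k) \<le> 1 / (A' * A) * M" if "P c" "0 \<le> M" "\<forall>i\<in>sample_index L m. norm (app c i) \<le> M" for c M k
    proof -
      have "ennreal (A' * A * norm (c k)) = ennreal A' * (ennreal A * ennreal (norm (c k)))"
        using A'(1) AB by (simp add: ennreal_mult mult.assoc)
      also have "\<dots> \<le> ennreal A' * (ennreal A * sup_seq c)"
        unfolding sup_seq_def by (intro mult_left_mono SUP_upper) auto
      also have "\<dots> \<le> ennreal A' * sup_fun (shiftsum g c)"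
        by (intro mult_left_mono stab that) simp
      also have "\<dots> \<le> Y c" by (rule A'(2)[OF that(1)])
      also have "\<dots> \<le> ennreal M"
        unfolding Y_def by (intro SUP_least ennreal_leI) (use that in auto)
      finally have "A' * A * norm (c k) \<le> M" using that(2) by (simp add: ennreal_le_iff)
      then show ?thesis using A'(1) AB by (simp add: field_simps)
    qed
    then show "lower_linf P"
      unfolding lower_linf_def using A'(1) AB by (intro exI[of _ "1 / (A' * A)"]) auto
  next
    assume "lower_linf P"
    then obtain C where C: "0 < C" "\<And>c M k. P c \<Longrightarrow> 0 \<le> M \<Longrightarrow> (\<forall>i\<in>sample_index L m. norm (app c i) \<le> M) \<Longrightarrow> norm (c k) \<le> C * M"
      unfolding lower_linf_def by blast
    define D where "D = \<Theta> + 1"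
    have D: "0 < D" unfolding D_def using Theta_nonneg by simp
    have "ennreal (1 / (B * C)) * sup_fun (shiftsum g c) \<le> Y c \<and> Y c \<le> ennreal (D / A) * sup_fun (shiftsum g c)"
      if c: "P c" for c
    proof
      \<comment> \<open>\<open>Y c\<close> is an extended real, while \<open>lower_linf\<close>
        speaks of real bounds. If it is infinite, the right side is infinite because
        \<open>C > 0\<close>.\<close>
      have "sup_seq c \<le> ennreal C * Y c"
      proof (cases "Y c")
        case (real M)
        have "norm (app c i) \<le> M" if "i \<in> sample_index L m" for i
        proof -
          have "ennreal (norm (app c i)) \<le> Y c" unfolding Y_def by (rule SUP_upper[OF that])
          then show ?thesis using real by (simp add: ennreal_le_iff)
        qed
        then have "norm (c k) \<le> C * M" for k by (intro C(2)[OF c]) (use real in auto)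
        then have "sup_seq c \<le> ennreal (C * M)"
          unfolding sup_seq_def by (intro SUP_least ennreal_leI)
        then show ?thesis using real C(1) by (simp add: ennreal_mult)
      next
        case top
        then show ?thesis using C(1) by (simp add: ennreal_mult_top)
      qed
      then have "sup_fun (shiftsum g c) \<le> ennreal B * (ennreal C * Y c)"
        using stab(2)[OF c] by (meson mult_left_mono order_trans zero_le)
      then have "ennreal (1 / (B * C)) * sup_fun (shiftsum g c) \<le> ennreal (1 / (B * C)) * (ennreal B * (ennreal C * Y c))"
        by (intro mult_left_mono) auto
      also have "\<dots> = ennreal (1 / (B * C) * B * C) * Y c"
        using AB C(1) by (subst ennreal_mult, simp, simp)+ (simp add: mult.assoc)
      also have "\<dots> = Y c" using AB C(1) by simp
      finally show "ennreal (1 / (B * C)) * sup_fun (shiftsum g c) \<le> Y c" .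
      obtain K0 where K0: "\<And>k. norm (c k) \<le> K0" using bdd[OF c] by blast
      have "sup_seq c \<le> ennreal K0"
        unfolding sup_seq_def by (intro SUP_least ennreal_leI K0)
      then obtain K where K: "sup_seq c = ennreal K" "0 \<le> K"
        by (cases "sup_seq c") (auto simp: top_unique)
      have cK: "norm (c k) \<le> K" for k
      proof -
        have "ennreal (norm (c k)) \<le> sup_seq c" unfolding sup_seq_def by (rule SUP_upper) simp
        then show ?thesis using K by (simp add: ennreal_le_iff)
      qed
      have "Y c \<le> ennreal (D * K)"
        unfolding Y_def
      proof (intro SUP_least ennreal_leI)
        fix i assume "i \<in> sample_index L m"
        then have "norm (app c i) \<le> \<Theta> * K" by (rule app_upper_linf[OF _ cK])
        also have "\<dots> \<le> D * K" unfolding D_def using K by (simp add: algebra_simps)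
        finally show "norm (app c i) \<le> D * K" .
      qed
      also have "\<dots> = ennreal (D / A) * (ennreal A * sup_seq c)"
        using D AB K by (simp add: mult.assoc[symmetric] ennreal_mult[symmetric])
      also have "\<dots> \<le> ennreal (D / A) * sup_fun (shiftsum g c)"
        by (intro mult_left_mono stab c) simp
      finally show "Y c \<le> ennreal (D / A) * sup_fun (shiftsum g c)" .
    qed
    then show "sampling_set g \<infinity> L m"
      unfolding samp using C(1) AB D by (intro exI[of _ "1 / (B * C)"] exI[of _ "D / A"]) auto
  qed
  then show ?thesis unfolding P_def .
qed

lemma sampling_lp_imp_linf:
  assumes "1 \<le> p" "sampling_set g (ereal p) L m"
  shows "sampling_set g \<infinity> L m"
proof -
  have "lower_lp p finsupp"
    using assms(2) finsupp_lp unfolding sampling_lp_iff[OF assms(1)] lower_lp_def by blast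
  then show ?thesis
    unfolding sampling_linf_iff by (rule lower_lp_imp_lower_linf[OF assms(1)])
qed

lemma lower_linf_finsupp_imp_sampling_lp:
  assumes "1 \<le> p" "lower_linf finsupp"
  shows "sampling_set g (ereal p) L m"
  unfolding sampling_lp_iff[OF assms(1)] by (rule lower_linf_imp_lower_lp[OF assms])

lemma sampling_linf_imp_all:
  assumes "1 \<le> p" "sampling_set g \<infinity> L m"
  shows "sampling_set g p L m"
proof (cases p)
  case (real r)
  have "lower_linf finsupp"
    using assms(2) finsupp_bounded unfolding sampling_linf_iff lower_linf_def by blast
  then show ?thesis
    using real assms(1) by (auto intro: lower_linf_finsupp_imp_sampling_lp)
qed (use assms in auto)

lemma sampling_some_imp_linf:
  assumes "1 \<le> p" "sampling_set g p L m"
  shows "sampling_set g \<infinity> L m"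
  using assms by (cases p) (auto intro: sampling_lp_imp_linf)

end

section \<open>Weak limits\<close>

lemma weak_conv_separated:
  assumes \<delta>: "0 < \<delta>" and sep: "\<And>n. \<forall>x\<in>S n. \<forall>y\<in>S n. x \<noteq> y \<longrightarrow> \<delta> \<le> \<bar>x - y\<bar>" and "weak_conv S G"
  shows "\<forall>x\<in>G. \<forall>y\<in>G. x \<noteq> y \<longrightarrow> \<delta> \<le> \<bar>x - y\<bar>"
proof (intro ballI impI, rule ccontr)
  fix x y assume xy: "x \<in> G" "y \<in> G" "x \<noteq> y" "\<not> \<delta> \<le> \<bar>x - y\<bar>"
  \<comment> \<open>The first half of the minimum forces approximants of \<open>x\<close> and
    \<open>y\<close> to be distinct, the second forces them to be closer than
    \<open>\<delta>\<close>.\<close>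
  define \<epsilon> where "\<epsilon> = min (\<bar>x - y\<bar> / 2) ((\<delta> - \<bar>x - y\<bar>) / 2)"
  have \<epsilon>: "0 < \<epsilon>" using xy by (auto simp: \<epsilon>_def)
  then obtain n where "G \<inter> {min x y - 1<..<max x y + 1} \<subseteq> nbhd (S n) \<epsilon>"
    using assms(3) unfolding weak_conv_def by (meson order_refl)
  moreover have "x \<in> {min x y - 1<..<max x y + 1}" "y \<in> {min x y - 1<..<max x y + 1}" by auto
  ultimately have "x \<in> nbhd (S n) \<epsilon>" "y \<in> nbhd (S n) \<epsilon>" using xy(1,2) by blast+
  then obtain x' y' where x': "x' \<in> S n" "\<bar>x - x'\<bar> < \<epsilon>" and y': "y' \<in> S n" "\<bar>y - y'\<bar> < \<epsilon>"
    by (auto simp: nbhd_def)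
  have e: "2 * \<epsilon> \<le> \<bar>x - y\<bar>" "2 * \<epsilon> \<le> \<delta> - \<bar>x - y\<bar>"
    by (simp_all add: \<epsilon>_def min_def)
  have "x' \<noteq> y'" using x' y' e by linarith
  then have "\<delta> \<le> \<bar>x' - y'\<bar>" using sep x' y' by blast
  then show False using x' y' e by linarith
qed

lemma separated_imp_closed:
  assumes "separated G"
  shows "closed G"
proof -
  obtain \<delta> where "0 < \<delta>" "\<forall>x\<in>G. \<forall>y\<in>G. x \<noteq> y \<longrightarrow> \<delta> \<le> \<bar>x - y\<bar>"
    using assms by (auto simp: separated_def)
  then show ?thesis
    by (intro discrete_imp_closed[of \<delta>]) (auto simp: dist_real_def, metis abs_minus_commute not_less)
qed

text \<open>A point of \<open>G'\<close> is approximated by points of \<open>S n\<close>, which in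
  turn lie close to \<open>G\<close>; closedness does the rest. Applied to level sets, this keeps
  every level of a weak limit inside its first level.\<close>

lemma weak_conv_mono:
  assumes "\<And>n. S' n \<subseteq> S n" "weak_conv S' G'" "weak_conv S G" "closed G"
  shows "G' \<subseteq> G"
proof
  fix x assume x: "x \<in> G'"
  have "\<exists>y\<in>G. dist y x < e" if e: "e > 0" for e
  proof -
    obtain n1 where n1: "\<And>n. n \<ge> n1 \<Longrightarrow> G' \<inter> {x - 1<..<x + 1} \<subseteq> nbhd (S' n) (e / 2)"
      using assms(2) e unfolding weak_conv_def by (meson half_gt_zero)
    obtain n2 where n2: "\<And>n. n \<ge> n2 \<Longrightarrow> S n \<inter> {x - e<..<x + e} \<subseteq> nbhd G (e / 2)"
      using assms(3) e unfolding weak_conv_def by (meson half_gt_zero)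
    define n where "n = max n1 n2"
    have "x \<in> nbhd (S' n) (e / 2)" using n1[of n] x by (auto simp: n_def)
    then obtain z where z: "z \<in> S' n" "\<bar>x - z\<bar> < e / 2" by (auto simp: nbhd_def)
    then have "x - e < z" "z < x + e" by linarith+
    then have "z \<in> S n \<inter> {x - e<..<x + e}" using assms(1)[of n] z(1) by auto
    then have "z \<in> nbhd G (e / 2)" using n2[of n] by (auto simp: n_def)
    then obtain y where "y \<in> G" "\<bar>z - y\<bar> < e / 2" by (auto simp: nbhd_def)
    moreover from this z have "dist y x < e" unfolding dist_real_def by linarith
    ultimately show ?thesis by blast
  qed
  then show "x \<in> G" using closed_approachable[OF assms(4)] by blast
qed

lemma translate_separated:
  assumes "\<forall>x\<in>L. \<forall>y\<in>L. x \<noteq> y \<longrightarrow> \<delta> \<le> \<bar>x - y\<bar>" "A \<subseteq> L"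
  shows "\<forall>x\<in>(\<lambda>x. x + t) ` A. \<forall>y\<in>(\<lambda>x. x + t) ` A. x \<noteq> y \<longrightarrow> \<delta> \<le> \<bar>x - (y::real)\<bar>"
  using assms by auto

text \<open>Separation passes to the limit with the same constant, which makes the first level
  closed, and closedness puts the higher levels inside it. Hence the matrix theorems apply to every
  weak limit as well.\<close>

lemma WZ_limit:
  assumes "1 \<le> N" "separated L" and WZ: "WZ N L m G mG"
  obtains Gs k where
    "\<And>j. j \<in> {1..N} \<Longrightarrow> weak_conv (\<lambda>n. (\<lambda>x. x + real_of_int (k n)) ` level_set L m j) (Gs j)"
    "separated G" "\<And>y. y \<in> G \<Longrightarrow> mG y \<le> N"
    "\<And>j y. j \<in> {1..N} \<Longrightarrow> y \<in> Gs j \<Longrightarrow> y \<in> G \<and> j \<le> mG y"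
proof -
  obtain Gs k where conv: "\<And>j. j \<in> {1..N} \<Longrightarrow> weak_conv (\<lambda>n. (\<lambda>x. x + real_of_int (k n)) ` level_set L m j) (Gs j)"
    and G: "G = Gs 1" and mG: "\<And>y. y \<in> G \<Longrightarrow> mG y = Max {j \<in> {1..N}. y \<in> Gs j}"
    using WZ unfolding WZ_def by blast
  obtain \<delta> where \<delta>: "0 < \<delta>" "\<forall>x\<in>L. \<forall>y\<in>L. x \<noteq> y \<longrightarrow> \<delta> \<le> \<bar>x - y\<bar>"
    using assms(2) by (auto simp: separated_def)
  have one: "1 \<in> {1..N}" using assms(1) by simp
  have "\<forall>x\<in>G. \<forall>y\<in>G. x \<noteq> y \<longrightarrow> \<delta> \<le> \<bar>x - y\<bar>"
    unfolding G
    by (rule weak_conv_separated[OF \<delta>(1) translate_separated[OF \<delta>(2)] conv[OF one]]) (auto simp: level_set_def)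
  then have sepG: "separated G" using \<delta>(1) by (auto simp: separated_def)
  have sub: "Gs j \<subseteq> G" if "j \<in> {1..N}" for j
    unfolding G
  proof (rule weak_conv_mono[OF _ conv[OF that] conv[OF one]])
    show "closed (Gs 1)" using separated_imp_closed[OF sepG] G by simp
  qed (use that in \<open>auto simp: level_set_def\<close>)
  show thesis
  proof (rule that[of k Gs])
    show "mG y \<le> N" if "y \<in> G" for y
    proof -
      have "Max {j \<in> {1..N}. y \<in> Gs j} \<in> {j \<in> {1..N}. y \<in> Gs j}"
        by (rule Max_in) (use that one G in auto)
      then show ?thesis using mG[OF that] by simp
    qed
    show "y \<in> G \<and> j \<le> mG y" if "j \<in> {1..N}" "y \<in> Gs j" for j y
    proof
      show y: "y \<in> G" using sub that by blast
      show "j \<le> mG y" unfolding mG[OF y] by (rule Max_ge) (use that in auto)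
    qed
  qed (use conv sepG in auto)
qed

section \<open>Finite combinations of shifts and the lower bound on weak limits\<close>

lemma shiftsum_translate: "shiftsum h (\<lambda>k. c (k + s)) x = shiftsum h c (x + real_of_int s)"
proof -
  have "shiftsum h c (x + real_of_int s) = (\<Sum>\<^sub>\<infinity>k\<in>UNIV. c (k + s) * h (x + real_of_int s - real_of_int (k + s)))"
    unfolding shiftsum_def by (rule infsum_reindex_bij_betw[OF bij_plus_right, symmetric])
  then show ?thesis by (simp add: shiftsum_def)
qed

text \<open>The cell suprema are summable, so outside a finite set of cells each of them is below
  \<open>e\<close>.\<close>

lemma W0_tendsto_0:
  assumes "W0 h"
  shows "(h \<longlongrightarrow> 0) at_infinity"
  unfolding Lim_at_infinity
proof (intro allI impI)
  fix e :: real assume e: "0 < e"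
  obtain F where F: "finite F" "dist (sum (cell_sup h) F) (infsum (cell_sup h) UNIV) \<le> e / 2"
    using infsum_finite_approximation[OF cell_sup_summable[OF assms], of "e / 2"] e by auto
  have small: "cell_sup h k < e" if "k \<notin> F" for k
  proof -
    have "sum (cell_sup h) (insert k F) \<le> infsum (cell_sup h) UNIV"
      by (rule finite_sum_le_infsum[OF cell_sup_summable[OF assms]]) (use F cell_sup_nonneg[OF assms] in auto)
    then have "cell_sup h k \<le> infsum (cell_sup h) UNIV - sum (cell_sup h) F"
      using F(1) that by simp
    then show ?thesis using F(2) e unfolding dist_real_def by linarith
  qed
  define b where "b = real_of_int (Max (insert 0 (abs ` F))) + 2"
  show "\<exists>b. \<forall>x. b \<le> norm x \<longrightarrow> dist (h x) 0 < e"
  proof (intro exI[of _ b] allI impI)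
    fix x :: real assume x: "b \<le> norm x"
    have "\<lfloor>x\<rfloor> \<notin> F"
    proof
      assume "\<lfloor>x\<rfloor> \<in> F"
      then have "\<bar>\<lfloor>x\<rfloor>\<bar> \<le> Max (insert 0 (abs ` F))" using F(1) by (intro Max_ge) auto
      then have "\<bar>real_of_int \<lfloor>x\<rfloor>\<bar> \<le> b - 2" unfolding b_def by linarith
      then show False using x by (simp, linarith)
    qed
    then show "dist (h x) 0 < e"
      using small norm_shift_le_cell_sup[OF assms, of x 0] by (simp add: dist_norm order_le_less_trans)
  qed
qed

lemma shiftsum_finsupp_tendsto_0:
  assumes "W0 h" "finsupp c"
  shows "(shiftsum h c \<longlongrightarrow> 0) at_infinity"
proof -
  define F where "F = {k. c k \<noteq> 0}"
  have F: "finite F" using assms(2) by (simp add: F_def finsupp_def)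
  have eq: "shiftsum h c = (\<lambda>x. \<Sum>k\<in>F. c k * h (x - real_of_int k))"
  proof
    fix x
    have "shiftsum h c x = (\<Sum>\<^sub>\<infinity>k\<in>F. c k * h (x - real_of_int k))"
      unfolding shiftsum_def by (rule infsum_cong_neutral) (auto simp: F_def)
    then show "shiftsum h c x = (\<Sum>k\<in>F. c k * h (x - real_of_int k))" using F by simp
  qed
  have "((\<lambda>x. h (x - real_of_int k)) \<longlongrightarrow> 0) at_infinity" for k
  proof (rule filterlim_compose[OF W0_tendsto_0[OF assms(1)]])
    have "filterlim (\<lambda>x::real. - real_of_int k + x) at_infinity at_infinity"
      by (rule tendsto_add_filterlim_at_infinity[OF tendsto_const filterlim_ident])
    then show "filterlim (\<lambda>x::real. x - real_of_int k) at_infinity at_infinity"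
      by simp
  qed
  then show ?thesis
    unfolding eq by (intro tendsto_null_sum tendsto_mult_right_zero)
qed

lemma sampling_rows_limit:
  assumes "1 \<le> N" "sampling_rows g N L m" and WZ: "WZ N L m G mG"
  shows "sampling_rows g N G mG"
proof -
  interpret L: sampling_rows g N L m by fact
  show ?thesis
    by (rule WZ_limit[OF assms(1) L.L WZ]) (unfold_locales, use L.W L.stable in auto)
qed

text \<open>The function of a finitely supported sequence is sampled on translates of
  \<open>L\<close>. Far out it is small by decay; on a bounded interval a translated point where
  order \<open>j\<close> is sampled is close to such a point of the limit, and uniform continuity
  compares the values. The samples are thus at most \<open>M + e\<close>, and the lower bound on
  \<open>L\<close> applies.\<close>

lemma lower_linf_limit:
  assumes "1 \<le> N" "sampling_rows g N L m" and WZ: "WZ N L m G mG"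
    and low: "localized_matrix.lower_linf (sample_index L m) (entry g) (\<lambda>c. bounded (range c))"
  shows "localized_matrix.lower_linf (sample_index G mG) (entry g) finsupp"
proof -
  interpret L: sampling_rows g N L m by fact
  interpret G: sampling_rows g N G mG by (rule sampling_rows_limit[OF assms(1-3)])
  obtain Gs s where conv: "\<And>j. j \<in> {1..N} \<Longrightarrow> weak_conv (\<lambda>n. (\<lambda>x. x + real_of_int (s n)) ` level_set L m j) (Gs j)"
    and lev: "\<And>j y. j \<in> {1..N} \<Longrightarrow> y \<in> Gs j \<Longrightarrow> y \<in> G \<and> j \<le> mG y"
    using WZ_limit[OF assms(1) L.L WZ] by metis

  obtain C where C: "C > 0" and stab: "\<And>c M k. bounded (range c) \<Longrightarrow> 0 \<le> M \<Longrightarrow> (\<forall>i\<in>sample_index L m. norm (L.app c i) \<le> M) \<Longrightarrow> norm (c k) \<le> C * M"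
    using low by (auto simp: L.lower_linf_def)
  have app: "L.app c (x, j) = shiftsum (nderiv j g) c x" for c x j
    by (simp only: L.app_def shiftsum_def entry_def mult.commute fst_conv snd_conv)
  have "norm (c k) \<le> C * M" if c: "finsupp c" and M: "0 \<le> M" "\<forall>i\<in>sample_index G mG. norm (L.app c i) \<le> M" for c M k
  proof (rule field_le_epsilon)
    fix e0 :: real assume e0: "0 < e0"
    \<comment> \<open>Chosen so that \<open>C * (M + e) = C * M + e0\<close>.\<close>
    define e where "e = e0 / C"
    have e: "0 < e" using e0 C by (simp add: e_def)
    obtain K where K: "\<And>k. norm (c k) \<le> K" using finsupp_bounded[OF c] by (auto simp: bounded_iff)
    have "\<forall>\<^sub>F n in sequentially. \<forall>l\<in>L. j < m l \<longrightarrow> norm (shiftsum (nderiv j g) c (l + real_of_int (s n))) \<le> M + e"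
      if j: "j < N" for j
    proof -
      define f where "f = shiftsum (nderiv j g) c"
      have W: "W0 (nderiv j g)" using L.W j by (simp add: W0N_def)
      obtain T where T: "\<And>x. T \<le> \<bar>x\<bar> \<Longrightarrow> norm (f x) < e"
        using shiftsum_finsupp_tendsto_0[OF W c] e unfolding Lim_at_infinity f_def by (auto simp: dist_norm)
      have "continuous_on UNIV f"
        unfolding continuous_on_def f_def
        by (intro ballI shiftsum_tendsto[OF W _ tendsto_const K tendsto_ident_at]) simp
      then have "uniformly_continuous_on {- T - 1..T + 1} f"
        by (intro compact_uniformly_continuous) (auto intro: continuous_on_subset)
      then obtain d where d: "0 < d" "\<And>x y. x \<in> {- T - 1..T + 1} \<Longrightarrow> y \<in> {- T - 1..T + 1} \<Longrightarrow> dist y x < d \<Longrightarrow> dist (f y) (f x) < e"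
        unfolding uniformly_continuous_on_def using e by meson
      \<comment> \<open>Order \<open>j\<close> is sampled exactly at the points of multiplicity at
        least \<open>j + 1\<close>, that is, on level \<open>Suc j\<close>.\<close>
      have j1: "Suc j \<in> {1..N}" using j by simp
      \<comment> \<open>The bound 1 keeps the approximating point inside
        \<open>{- T - 1..T + 1}\<close>, where uniform continuity was established.\<close>
      have "0 < min d 1" using d by simp
      then obtain n0 where n0: "\<And>n. n \<ge> n0 \<Longrightarrow> (\<lambda>x. x + real_of_int (s n)) ` level_set L m (Suc j) \<inter> {- T<..<T} \<subseteq> nbhd (Gs (Suc j)) (min d 1)"
        using conv[OF j1] unfolding weak_conv_def by meson
      show ?thesis
        unfolding f_def[symmetric] using eventually_ge_at_top[of n0]
      proof (rule eventually_mono, intro ballI impI)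
        fix n l assume n: "n0 \<le> n" and l: "l \<in> L" "j < m l"
        define x where "x = l + real_of_int (s n)"
        have "norm (f x) \<le> M + e"
        proof (cases "T \<le> \<bar>x\<bar>")
          case True
          then show ?thesis using T[of x] M(1) by simp
        next
          case False
          then have "x \<in> (\<lambda>x. x + real_of_int (s n)) ` level_set L m (Suc j) \<inter> {- T<..<T}"
            using l by (auto simp: x_def level_set_def)
          then obtain y where y: "y \<in> Gs (Suc j)" "\<bar>x - y\<bar> < min d 1"
            using n0[OF n] by (auto simp: nbhd_def)
          then have "(y, j) \<in> sample_index G mG" using lev[OF j1 y(1)] by (auto simp: sample_index_def)
          then have "norm (f y) \<le> M" using M(2) app by (auto simp: f_def)
          moreover have "dist (f x) (f y) < e"
            using False y by (intro d(2)) (auto simp: dist_real_def)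
          ultimately show ?thesis
            using norm_triangle_ineq2[of "f x" "f y"] by (simp add: dist_norm)
        qed
        then show "norm (f (l + real_of_int (s n))) \<le> M + e" by (simp add: x_def)
      qed
    qed
    then have ev: "\<forall>\<^sub>F n in sequentially. \<forall>j\<in>{..<N}. \<forall>l\<in>L. j < m l \<longrightarrow> norm (shiftsum (nderiv j g) c (l + real_of_int (s n))) \<le> M + e"
      by (intro eventually_ball_finite) auto
    obtain n where n: "\<And>j l. j < N \<Longrightarrow> l \<in> L \<Longrightarrow> j < m l \<Longrightarrow> norm (shiftsum (nderiv j g) c (l + real_of_int (s n))) \<le> M + e"
    proof -
      from eventually_happens'[OF sequentially_bot ev] obtain n where
        "\<forall>j\<in>{..<N}. \<forall>l\<in>L. j < m l \<longrightarrow> norm (shiftsum (nderiv j g) c (l + real_of_int (s n))) \<le> M + e" ..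
      then show thesis by (intro that[of n]) auto
    qed
    \<comment> \<open>Shifting the coefficients by \<open>s n\<close> moves the sampling from the
      translate of \<open>L\<close> back to \<open>L\<close> itself.\<close>
    define c' where "c' k = c (k + s n)" for k
    have "norm (c' (k - s n)) \<le> C * (M + e)"
    proof (rule stab)
      show "bounded (range c')" using K by (auto simp: bounded_iff c'_def)
      show "0 \<le> M + e" using M e by simp
      show "\<forall>i\<in>sample_index L m. norm (L.app c' i) \<le> M + e"
      proof
        fix i assume "i \<in> sample_index L m"
        then obtain l j where i: "i = (l, j)" "l \<in> L" "j < m l" by (auto simp: sample_index_def)
        then have "j < N" using L.m by (meson less_le_trans)
        have "L.app c' i = shiftsum (nderiv j g) c (l + real_of_int (s n))"
          unfolding i(1) app c'_def[abs_def] by (rule shiftsum_translate)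
        then show "norm (L.app c' i) \<le> M + e" using n[OF \<open>j < N\<close> i(2,3)] by simp
      qed
    qed
    then show "norm (c k) \<le> C * M + e0" using C by (simp add: c'_def e_def distrib_left)
  qed
  then show "localized_matrix.lower_linf (sample_index G mG) (entry g) finsupp"
    unfolding G.lower_linf_def using C by blast
qed

text \<open>Cells of length \<open>w\<close> contain at most one point of each set; the position inside the cell is recorded by
  \<open>offset\<close>, with the value 2 marking an empty cell.\<close>
definition offset :: "real \<Rightarrow> real set \<Rightarrow> int \<Rightarrow> real" where
  "offset w S i = (if \<exists>x\<in>S. \<lfloor>x / w\<rfloor> = i then (SOME x. x \<in> S \<and> \<lfloor>x / w\<rfloor> = i) - real_of_int i * w else 2)"

lemma offset_nonempty:
  assumes "0 < w" "offset w S i \<noteq> 2"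
  shows "real_of_int i * w + offset w S i \<in> S" "0 \<le> offset w S i" "offset w S i < w"
proof -
  have ex: "\<exists>x. x \<in> S \<and> \<lfloor>x / w\<rfloor> = i" using assms(2) by (auto simp: offset_def split: if_splits)
  define x where "x = (SOME x. x \<in> S \<and> \<lfloor>x / w\<rfloor> = i)"
  have x: "x \<in> S" "\<lfloor>x / w\<rfloor> = i" using someI_ex[OF ex] by (auto simp: x_def)
  have off: "offset w S i = x - real_of_int i * w"
    using ex by (auto simp: offset_def x_def)
  have "real_of_int i \<le> x / w" "x / w < real_of_int i + 1" using x(2) by linarith+
  then show "real_of_int i * w + offset w S i \<in> S" "0 \<le> offset w S i" "offset w S i < w"
    using x(1) assms(1) by (auto simp: off field_simps)
qed

lemma offset_bounds:
  assumes "0 < w" "w \<le> 1"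
  shows "0 \<le> offset w S i" "offset w S i \<le> 2"
  using offset_nonempty(2,3)[OF assms(1), of S i] assms by (cases "offset w S i = 2"; simp)+

lemma offset_eq:
  assumes "0 < w" "w < \<delta>" "\<forall>x\<in>S. \<forall>y\<in>S. x \<noteq> y \<longrightarrow> \<delta> \<le> \<bar>x - y\<bar>" "x \<in> S"
  shows "offset w S \<lfloor>x / w\<rfloor> = x - real_of_int \<lfloor>x / w\<rfloor> * w"
proof -
  have inj: "inj_on (\<lambda>x. \<lfloor>x / w\<rfloor>) S"
    by (rule floor_div_inj_on) (use assms in fastforce)+
  have "(SOME y. y \<in> S \<and> \<lfloor>y / w\<rfloor> = \<lfloor>x / w\<rfloor>) = x"
    by (rule some_equality) (use assms(4) inj in \<open>auto dest: inj_onD\<close>)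
  then show ?thesis using assms(4) by (auto simp: offset_def)
qed

lemma weak_conv_offset:
  assumes w: "0 < w" "w < \<delta>" "w \<le> 1 / 2" and sep: "\<And>n. \<forall>x\<in>S n. \<forall>y\<in>S n. x \<noteq> y \<longrightarrow> \<delta> \<le> \<bar>x - y\<bar>"
    and lim: "\<And>i. (\<lambda>n. offset w (S n) i) \<longlonglongrightarrow> ofs i"
  shows "weak_conv S {real_of_int i * w + ofs i | i. ofs i < 1}"
  unfolding weak_conv_def
proof (intro allI impI)
  fix a b \<epsilon> :: real assume \<epsilon>: "0 < \<epsilon>"
  \<comment> \<open>The cells that can contribute to \<open>{a<..<b}\<close>. The lower end starts
    from \<open>a - 1\<close> because a limit point exceeds the left end of its cell by
    \<open>ofs i\<close>, of which only \<open>ofs i < 1\<close> is used.\<close>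
  define J where "J = {\<lfloor>(a - 1) / w\<rfloor> - 1..\<lceil>b / w\<rceil> + 1}"
  \<comment> \<open>The tolerance 1/2 preserves occupancy in both directions: an offset below 1/2
    forces a limit below 1, and a limit below 1 forces an offset different from 2.\<close>
  have "\<forall>\<^sub>F n in sequentially. \<forall>i\<in>J. dist (offset w (S n) i) (ofs i) < min \<epsilon> (1 / 2)"
    using \<epsilon> by (intro eventually_ball_finite ballI tendstoD[OF lim]) (auto simp: J_def)
  then obtain n0 where n0: "\<And>n i. n \<ge> n0 \<Longrightarrow> i \<in> J \<Longrightarrow> \<bar>offset w (S n) i - ofs i\<bar> < min \<epsilon> (1 / 2)"
    unfolding eventually_sequentially dist_real_def by blast
  have ofs0: "0 \<le> ofs i" for i
    by (rule LIMSEQ_le_const[OF lim]) (use offset_bounds(1) w in auto)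
  show "\<exists>n0. \<forall>n\<ge>n0. S n \<inter> {a<..<b} \<subseteq> nbhd {real_of_int i * w + ofs i | i. ofs i < 1} \<epsilon> \<and>
      {real_of_int i * w + ofs i | i. ofs i < 1} \<inter> {a<..<b} \<subseteq> nbhd (S n) \<epsilon>"
  proof (intro exI[of _ n0] allI impI conjI subsetI)
    fix n x assume n: "n0 \<le> n" and "x \<in> S n \<inter> {a<..<b}"
    then have x: "x \<in> S n" "a < x" "x < b" by auto
    define i where "i = \<lfloor>x / w\<rfloor>"
    have "(a - 1) / w \<le> x / w" "x / w \<le> b / w"
      using x w by (auto intro!: divide_right_mono)
    then have "i \<in> J" unfolding J_def i_def by (auto, linarith+)
    moreover have off: "offset w (S n) i = x - real_of_int i * w"
      unfolding i_def by (rule offset_eq[OF w(1,2) sep x(1)])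
    ultimately have d: "\<bar>(x - real_of_int i * w) - ofs i\<bar> < min \<epsilon> (1 / 2)"
      using n0[OF n] by metis
    have "x / w < real_of_int i + 1" unfolding i_def by linarith
    then have "x - real_of_int i * w < w" using w by (simp add: field_simps)
    then have "ofs i < 1" using d w by linarith
    then show "x \<in> nbhd {real_of_int i * w + ofs i | i. ofs i < 1} \<epsilon>"
      unfolding nbhd_def using d by (intro CollectI bexI[of _ "real_of_int i * w + ofs i"]) auto
  next
    fix n y assume n: "n0 \<le> n" and "y \<in> {real_of_int i * w + ofs i | i. ofs i < 1} \<inter> {a<..<b}"
    then obtain i where y: "y = real_of_int i * w + ofs i" "ofs i < 1" "a < y" "y < b" by auto
    have "(a - 1) / w \<le> real_of_int i" "real_of_int i \<le> b / w"
      using y ofs0[of i] w by (auto simp: pos_divide_le_eq pos_le_divide_eq)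
    then have "i \<in> J" unfolding J_def by (auto, linarith+)
    then have d: "\<bar>offset w (S n) i - ofs i\<bar> < min \<epsilon> (1 / 2)" using n0[OF n] by blast
    then have "offset w (S n) i \<noteq> 2" using y(2) by linarith
    from offset_nonempty(1)[OF w(1) this] show "y \<in> nbhd (S n) \<epsilon>"
      unfolding nbhd_def using d y(1) by (intro CollectI bexI[of _ "real_of_int i * w + offset w (S n) i"]) auto
  qed
qed

section \<open>Sampling and uniqueness on weak limits\<close>

context sampling_rows
begin

lemma app_eq_shiftsum: "app c (x, j) = shiftsum (nderiv j g) c x"
  by (simp only: app_def shiftsum_def entry_def mult.commute fst_conv snd_conv)

text \<open>Vanishing samples permit \<open>M = 0\<close> in the lower bound, so all coefficients
  vanish.\<close>

lemma sampling_linf_imp_uniqueness: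
  assumes "sampling_set g \<infinity> L m"
  shows "uniqueness_set g L m"
  unfolding uniqueness_set_def
proof (intro ballI impI allI)
  fix f x assume "f \<in> Vp g \<infinity>" and zero: "\<forall>y\<in>L. \<forall>j<m y. nderiv j f y = 0"
  then obtain c where c: "f = shiftsum g c" "bounded (range c)"
    by (auto simp: Vp_def lp_space_def)
  then obtain K where K: "\<And>k. norm (c k) \<le> K" by (auto simp: bounded_iff)
  have C: "\<exists>C. \<forall>k. norm (c k) \<le> C * 0" if "\<forall>i\<in>sample_index L m. norm (app c i) \<le> 0"
    using assms c(2) that unfolding sampling_linf_iff lower_linf_def by blast
  have "\<forall>i\<in>sample_index L m. norm (app c i) \<le> 0"
  proof
    fix i assume i: "i \<in> sample_index L m"
    then have "nderiv (snd i) f (fst i) = 0" using zero by (auto simp: sample_index_def)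
    then show "norm (app c i) \<le> 0" using nderiv_eq_app[OF i K] c(1) by simp
  qed
  from C[OF this] have "c k = 0" for k by auto
  then show "f x = 0" by (simp add: c(1) shiftsum_def)
qed

text \<open>The supremum of the coefficients need not be attained, so an index carrying more than
  half of it is moved to 0. The bound 1/2 at that index later prevents the limit sequence from
  vanishing.\<close>

lemma not_lower_linf_witness:
  assumes "\<not> lower_linf (\<lambda>c. bounded (range c))" and "0 < C"
  shows "\<exists>d s. (\<forall>k. norm (d k) \<le> 1) \<and> 1 / 2 \<le> norm (d 0) \<and>
    (\<forall>l\<in>L. \<forall>j<m l. norm (shiftsum (nderiv j g) d (l + real_of_int s)) \<le> 1 / C)"
proof -
  obtain c M k0 where c: "bounded (range c)" "0 \<le> M" "\<forall>i\<in>sample_index L m. norm (app c i) \<le> M" "\<not> norm (c k0) \<le> C * M"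
    using assms unfolding lower_linf_def by blast
  define K where "K = (SUP k. norm (c k))"
  have bdd: "bdd_above (range (\<lambda>k. norm (c k)))"
    using c(1) by (auto simp: bounded_iff bdd_above_def)
  have K: "norm (c k) \<le> K" for k unfolding K_def by (rule cSUP_upper[OF _ bdd]) simp
  have "C * M < norm (c k0)" using c(4) by simp
  then have CM: "C * M < K" using K[of k0] by linarith
  then have K0: "0 < K" using assms(2) c(2) by (meson less_le_not_le mult_nonneg_nonneg not_le order_le_less_trans)
  have "\<exists>k1. K / 2 < norm (c k1)"
  proof (rule ccontr)
    assume "\<nexists>k1. K / 2 < norm (c k1)"
    then have "K \<le> K / 2" by (subst K_def, intro cSUP_least) (auto simp: not_less)
    then show False using K0 by simp
  qed
  then obtain k1 where k1: "K / 2 < norm (c k1)" ..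
  define d where "d k = of_real (1 / K) * c (k + k1)" for k
  show ?thesis
  \<comment> \<open>The set is translated by \<open>- k1\<close> along with the coefficients: the
    samples of \<open>d\<close> there are those of \<open>c\<close> on \<open>L\<close>, divided by
    \<open>K\<close>, and \<open>C * M < K\<close> makes them at most \<open>1 / C\<close>.\<close>
  proof (intro exI[of _ d] exI[of _ "- k1"] conjI allI ballI impI)
    show "norm (d k) \<le> 1" for k
      using K[of "k + k1"] K0 by (simp add: d_def norm_mult norm_divide)
    show "1 / 2 \<le> norm (d 0)"
      using k1 K0 by (simp add: d_def norm_mult norm_divide field_simps)
    fix l j assume l: "l \<in> L" "j < m l"
    have "shiftsum (nderiv j g) d (l + real_of_int (- k1))
        = of_real (1 / K) * shiftsum (nderiv j g) (\<lambda>k. c (k + k1)) (l + real_of_int (- k1))"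
      unfolding shiftsum_def d_def mult.assoc by (rule infsum_cmult_right')
    also have "\<dots> = of_real (1 / K) * app c (l, j)"
      by (simp add: shiftsum_translate app_eq_shiftsum)
    finally have "norm (shiftsum (nderiv j g) d (l + real_of_int (- k1))) = norm (app c (l, j)) / K"
      using K0 by (simp add: norm_mult norm_divide)
    also have "\<dots> \<le> M / K"
      using c(3) l K0 by (intro divide_right_mono) (auto simp: sample_index_def)
    also have "\<dots> \<le> 1 / C"
      using CM K0 assms(2) by (simp add: field_simps)
    finally show "norm (shiftsum (nderiv j g) d (l + real_of_int (- k1))) \<le> 1 / C" .
  qed
qed

theorem uniqueness_limits_imp_sampling:
  assumes N: "1 \<le> N" and uniq: "\<And>G mG. WZ N L m G mG \<Longrightarrow> uniqueness_set g G mG"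
  shows "sampling_set g \<infinity> L m"
proof (rule ccontr)
  assume "\<not> sampling_set g \<infinity> L m"
  then have "\<forall>n. \<exists>d s. (\<forall>k. norm (d k) \<le> 1) \<and> 1 / 2 \<le> norm (d 0) \<and>
    (\<forall>l\<in>L. \<forall>j<m l. norm (shiftsum (nderiv j g) d (l + real_of_int s)) \<le> 1 / real (Suc n))"
    unfolding sampling_linf_iff by (intro allI not_lower_linf_witness) auto
  then obtain d s where d: "\<And>n k. norm (d n k) \<le> 1" "\<And>n. 1 / 2 \<le> norm (d n 0)"
    "\<And>n l j. l \<in> L \<Longrightarrow> j < m l \<Longrightarrow> norm (shiftsum (nderiv j g) (d n) (l + real_of_int (s n))) \<le> 1 / real (Suc n)"
    by metis
  obtain \<delta> where \<delta>: "0 < \<delta>" "\<forall>x\<in>L. \<forall>y\<in>L. x \<noteq> y \<longrightarrow> \<delta> \<le> \<bar>x - y\<bar>"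
    using L by (auto simp: separated_def)
  define w where "w = min \<delta> 1 / 2"
  have w: "0 < w" "w < \<delta>" "w \<le> 1 / 2" using \<delta>(1) by (auto simp: w_def)
  define S where "S n j = (\<lambda>x. x + real_of_int (s n)) ` level_set L m j" for n j
  \<comment> \<open>Coefficients and offsets of all levels are packed into one bounded function on a
    countable index set, so a single diagonal extraction makes them converge along the same
    subsequence. The bound 2 is dictated by the marker of an empty cell.\<close>
  define F where "F n z = (case z of Inl k \<Rightarrow> d n k | Inr (j, i) \<Rightarrow> complex_of_real (offset w (S n j) i))" for n and z :: "int + nat \<times> int"
  have F_le: "norm (F n z) \<le> 2" for n z
    using d(1) offset_bounds[of w] w
    by (auto simp: F_def split: sum.split prod.split intro: order_trans[of _ 1])
  obtain r :: "nat \<Rightarrow> nat" where r: "strict_mono r" "\<And>z. \<exists>l. (\<lambda>n. F (r n) z) \<longlonglongrightarrow> l"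
    using function_convergent_subsequence[of UNIV F 2] F_le by auto
  from r(2) obtain lim where lim: "\<And>z. (\<lambda>n. F (r n) z) \<longlonglongrightarrow> lim z" by metis
  define c where "c k = lim (Inl k)" for k
  define ofs where "ofs j i = Re (lim (Inr (j, i)))" for j i
  have dc: "(\<lambda>n. d (r n) k) \<longlonglongrightarrow> c k" for k
    using lim[of "Inl k"] by (simp add: F_def c_def)
  have off: "(\<lambda>n. offset w (S (r n) j) i) \<longlonglongrightarrow> ofs j i" for j i
    using tendsto_Re[OF lim[of "Inr (j, i)"]] by (simp add: F_def ofs_def)
  have c1: "norm (c k) \<le> 1" for k
    by (rule LIMSEQ_le_const2[OF tendsto_norm[OF dc]]) (use d(1) in auto)
  have c0: "1 / 2 \<le> norm (c 0)"
    by (rule LIMSEQ_le_const[OF tendsto_norm[OF dc]]) (use d(2) in auto)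
  define Gs where "Gs j = {real_of_int i * w + ofs j i | i. ofs j i < 1}" for j
  define mG where "mG y = Max {j \<in> {1..N}. y \<in> Gs j}" for y
  have "weak_conv (\<lambda>n. (\<lambda>x. x + real_of_int ((s \<circ> r) n)) ` level_set L m j) (Gs j)" for j
    unfolding Gs_def
  proof (rule weak_conv_offset[OF w])
    show "(\<lambda>n. offset w ((\<lambda>x. x + real_of_int ((s \<circ> r) n)) ` level_set L m j) i) \<longlonglongrightarrow> ofs j i" for i
      using off[of j i] by (simp add: S_def)
    show "\<forall>x\<in>(\<lambda>x. x + real_of_int ((s \<circ> r) n)) ` level_set L m j.
        \<forall>y\<in>(\<lambda>x. x + real_of_int ((s \<circ> r) n)) ` level_set L m j. x \<noteq> y \<longrightarrow> \<delta> \<le> \<bar>x - y\<bar>" for n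
      by (rule translate_separated[OF \<delta>(2)]) (auto simp: level_set_def)
  qed
  then have "WZ N L m (Gs 1) mG"
    unfolding WZ_def mG_def by (intro exI[of _ Gs] exI[of _ "s \<circ> r"]) auto
  then have U: "uniqueness_set g (Gs 1) mG" by (rule uniq)
  have zero: "nderiv j (shiftsum g c) y = 0" if y: "y \<in> Gs 1" and j: "j < mG y" for y j
  proof -
    have "mG y \<in> {j \<in> {1..N}. y \<in> Gs j}"
      unfolding mG_def by (rule Max_in) (use y N in auto)
    then have q: "mG y \<in> {1..N}" "y \<in> Gs (mG y)" by auto
    then have jN: "j < N" using j by auto
    have Wj: "W0 (nderiv j g)" using W jN by (simp add: W0N_def)
    obtain i where i: "y = real_of_int i * w + ofs (mG y) i" "ofs (mG y) i < 1"
      using q(2) unfolding Gs_def by blast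
    \<comment> \<open>These points tend to \<open>y\<close>. As the limit offset is below 1, the
      cell is eventually occupied, and then \<open>x n\<close> is a translated point of multiplicity
      at least \<open>mG y > j\<close>; hence order \<open>j\<close> at \<open>x n\<close> is among
      the small samples.\<close>
    define x where "x n = real_of_int i * w + offset w (S (r n) (mG y)) i" for n
    have "x \<longlonglongrightarrow> y"
      unfolding x_def by (subst i(1)) (intro tendsto_intros off)
    then have lim1: "(\<lambda>n. shiftsum (nderiv j g) (d (r n)) (x n)) \<longlonglongrightarrow> shiftsum (nderiv j g) c y"
      by (intro shiftsum_tendsto[OF Wj _ dc d(1)]) auto
    have "\<forall>\<^sub>F n in sequentially. offset w (S (r n) (mG y)) i < 1"
      by (rule order_tendstoD(2)[OF off i(2)])
    then have "\<forall>\<^sub>F n in sequentially. norm (shiftsum (nderiv j g) (d (r n)) (x n)) \<le> 1 / real (Suc n)"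
    proof (rule eventually_mono)
      fix n assume "offset w (S (r n) (mG y)) i < 1"
      then have "x n \<in> S (r n) (mG y)"
        unfolding x_def by (intro offset_nonempty(1)[OF w(1)]) auto
      then obtain l where l: "x n = l + real_of_int (s (r n))" "l \<in> L" "mG y \<le> m l"
        by (auto simp: S_def level_set_def)
      have "norm (shiftsum (nderiv j g) (d (r n)) (x n)) \<le> 1 / real (Suc (r n))"
        unfolding l(1) by (rule d(3)) (use l j in auto)
      also have "\<dots> \<le> 1 / real (Suc n)"
        using seq_suble[OF r(1), of n] by (intro divide_left_mono) auto
      finally show "norm (shiftsum (nderiv j g) (d (r n)) (x n)) \<le> 1 / real (Suc n)" .
    qed
    then have lim0: "(\<lambda>n. shiftsum (nderiv j g) (d (r n)) (x n)) \<longlonglongrightarrow> 0"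
      by (rule Lim_null_comparison) (use LIMSEQ_inverse_real_of_nat in \<open>simp add: inverse_eq_divide\<close>)
    have "shiftsum (nderiv j g) c y = 0" by (rule LIMSEQ_unique[OF lim1 lim0])
    then show ?thesis by (simp only: nderiv_shiftsum[OF W jN c1])
  qed
  have bc: "bounded (range c)" using c1 by (auto simp: bounded_iff)
  then have "shiftsum g c \<in> Vp g \<infinity>" by (auto simp: Vp_def lp_space_def)
  then have "shiftsum g c x = 0" for x
    using U zero unfolding uniqueness_set_def by blast
  \<comment> \<open>A vanishing function has vanishing coefficients by the lower stability bound for
    the sup norm, contrary to the coefficient at 0 being at least 1/2 in modulus.\<close>
  then have sup0: "sup_fun (shiftsum g c) = 0" by (simp add: sup_fun_def)
  obtain A where A: "0 < A" "ennreal A * sup_seq c \<le> sup_fun (shiftsum g c)"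
    using stable bc unfolding stable_shifts_def lp_space_def by auto
  have "ennreal (norm (c 0)) \<le> sup_seq c" unfolding sup_seq_def by (rule SUP_upper) simp
  also have "sup_seq c = 0" using A sup0 by simp
  finally show False using c0 by simp
qed

end

theorem theorem3p4:
  fixes g :: "real \<Rightarrow> complex" and L :: "real set" and m :: "real \<Rightarrow> nat" and N :: nat
  assumes "1 \<le> N" and "W0N N g" and "stable_shifts g"
    and "mult_set L m" and "separated L" and "\<forall>l\<in>L. m l \<le> N"
  shows "((\<exists>p::ereal. 1 \<le> p \<and> sampling_set g p L m) \<longleftrightarrow>
            (\<forall>p::ereal. 1 \<le> p \<longrightarrow> sampling_set g p L m)) \<and>
         ((\<forall>p::ereal. 1 \<le> p \<longrightarrow> sampling_set g p L m) \<longleftrightarrow>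
            (\<forall>G mG. WZ N L m G mG \<longrightarrow> sampling_set g \<infinity> G mG)) \<and>
         ((\<forall>G mG. WZ N L m G mG \<longrightarrow> sampling_set g \<infinity> G mG) \<longleftrightarrow>
            (\<forall>G mG. WZ N L m G mG \<longrightarrow> uniqueness_set g G mG))"
proof -
  have S: "sampling_rows g N L m"
    by unfold_locales (use assms in auto)
  interpret L: sampling_rows g N L m by (rule S)
  have all: "\<forall>p::ereal. 1 \<le> p \<longrightarrow> sampling_set g p L m" if "sampling_set g \<infinity> L m"
    using L.sampling_linf_imp_all[OF _ that] by blast
  have some: "sampling_set g \<infinity> L m" if "1 \<le> p" "sampling_set g p L m" for p
    by (rule L.sampling_some_imp_linf[OF that])
  \<comment> \<open>The passage to the limit yields the lower bound on finitely supported sequences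
    only; the detour through \<open>p = 1\<close> recovers it for all bounded sequences.\<close>
  have lim: "sampling_set g \<infinity> G mG" if "sampling_set g \<infinity> L m" and WZ: "WZ N L m G mG" for G mG
  proof -
    interpret G: sampling_rows g N G mG by (rule sampling_rows_limit[OF assms(1) S WZ])
    have "G.lower_linf finsupp"
      by (rule lower_linf_limit[OF assms(1) S WZ that(1)[unfolded L.sampling_linf_iff]])
    then have "sampling_set g (ereal 1) G mG"
      by (rule G.lower_linf_finsupp_imp_sampling_lp[rotated]) simp
    then show ?thesis by (rule G.sampling_lp_imp_linf[rotated]) simp
  qed
  have uniq: "uniqueness_set g G mG" if "WZ N L m G mG" "sampling_set g \<infinity> G mG" for G mG
  proof -
    interpret G: sampling_rows g N G mG by (rule sampling_rows_limit[OF assms(1) S that(1)])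
    show ?thesis by (rule G.sampling_linf_imp_uniqueness[OF that(2)])
  qed
  have converse: "sampling_set g \<infinity> L m" if "\<forall>G mG. WZ N L m G mG \<longrightarrow> uniqueness_set g G mG"
    by (rule L.uniqueness_limits_imp_sampling[OF assms(1)]) (use that in blast)
  have inf: "(1::ereal) \<le> \<infinity>" by simp
  show ?thesis
    using all some lim uniq converse inf by meson
qed

end
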